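(* Let $(n,m)\in\mathbb{N}^2$ be any pair of natural numbers (positive integers). Then the Poisson maps $R_{n:-m}\colon\mathbb{C}_\times^2\to\mathbb{R}$ and $\mathbf{J}_{n:-m}\colon\mathbb{C}_\times^2\to\mathfrak{su}(1,1)^*_+$ (with respect to the bracket $\{\cdot,\cdot\}^{1:-1}$ on $\mathbb{C}_\times^2$) constitute a dual pair; that is, for every $\mathbf{a}\in\mathbb{C}_\times^2$, the subspaces $\ker T_{\mathbf{a}}R_{n:-m}$ and $\ker T_{\mathbf{a}}\mathbf{J}_{n:-m}$ of $T_{\mathbf{a}}\mathbb{C}_\times^2$ are symplectic orthogonal complements of each other with respect to $\Omega^{1:-1}$. This dual pair is related to the dual pair $R_{1:-1},\mathbf{J}_{1:-1}$ by $R_{n:-m}=R_{1:-1}\circ f_{n:m}$ and $\mathbf{J}_{n:-m}=\mathbf{J}_{1:-1}\circ f_{n:m}$. Moreover, the Kummer shape (the image under $\mathbf{J}_{n:-m}$ of a level set of $R_{n:-m}$) is a paraboloid for any $(n,m)\in\mathbb{N}^2$; in fact, setting $\mu=(\mu_1,\mu_2,\mu_3)=\mathbf{J}_{n:-m}(\mathbf{a})$, one has $$\mu_3^2-\mu_1^2-\mu_2^2=R_{n:-m}(\mathbf{a})^2.$$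
   Context: $\mathbb{C}_\times=\mathbb{C}\setminus\{0\}$ and $\mathbb{C}_\times^2=\{(b_1,b_2):b_1,b_2\in\mathbb{C}_\times\}$, regarded as a real 4-dimensional manifold. With $(k_1,k_2)=(1,-1)$, equip it with the symplectic form $\Omega^{1:-1}=-\frac{i}{2}\sum_{j=1}^2k_j\,db_j\wedge d\bar b_j$ and the Poisson bracket $$\{F,G\}^{1:-1}=2i\sum_{j=1}^2k_j\left(\frac{\partial F}{\partial b_j}\frac{\partial G}{\partial\bar b_j}-\frac{\partial G}{\partial b_j}\frac{\partial F}{\partial\bar b_j}\right).$$ $\mathbb{R}$ carries the zero Poisson bracket. For positive integers $n,m$ define $$f_{n:m}(a_1,a_2)=\left(\frac{a_1^m}{\sqrt m\,|a_1|^{m-1}},\frac{a_2^n}{\sqrt n\,|a_2|^{n-1}}\right),\qquad R_{n:-m}(\mathbf{a})=\frac12\left(\frac{|a_1|^2}{m}-\frac{|a_2|^2}{n}\right).$$ Let $K=\operatorname{diag}(1,-1)$, $\mathsf{SU}(1,1)=\{U\in\mathbb{C}^{2\times2}:U^*KU=K,\ \det U=1\}$, and let $\mathfrak{su}(1,1)$ be its Lie algebra. Identify $\mathfrak{su}(1,1)^*$ with $\mathfrak{su}(1,1)$ via the pairing $\langle\eta,\xi\rangle=\frac12\operatorname{tr}(\eta^*\xi)$; $\mathfrak{su}(1,1)^*_+$ denotes $\mathfrak{su}(1,1)^*$ with the $(+)$-Lie--Poisson bracket $\{F,G\}_+(\mu)=\langle\mu,[\partial F/\partial\mu,\partial G/\partial\mu]\rangle$.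 The map $\mathbf{J}_{1:-1}\colon\mathbb{C}_\times^2\to\mathfrak{su}(1,1)^*$, the momentum map of the natural action of $\mathsf{SU}(1,1)$ on $(\mathbb{C}_\times^2,\Omega^{1:-1})$, is $$\mathbf{J}_{1:-1}(\mathbf{b})=i\left(K\mathbf{b}\mathbf{b}^*-\tfrac12\operatorname{tr}(K\mathbf{b}\mathbf{b}^* )I\right)=\left(\operatorname{Re}(b_1\bar b_2),\,-\operatorname{Im}(b_1\bar b_2),\,\tfrac12(|b_1|^2+|b_2|^2)\right),$$ where $\mathfrak{su}(1,1)^*$ is identified with $\mathbb{R}^3$ by $i\begin{bmatrix}\mu_3&\mu_1-i\mu_2\\-(\mu_1+i\mu_2)&-\mu_3\end{bmatrix}\leftrightarrow(\mu_1,\mu_2,\mu_3)$. Set $\mathbf{J}_{n:-m}:=\mathbf{J}_{1:-1}\circ f_{n:m}$.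
   Formalization: The kernels are proved to be symplectic complements only where R_{n:-m}(a) ≠ 0 (the claim fails whenever R = 0, e.g. n=m=1, a=(1,1)); "paraboloid" is replaced by the exact image, the upper sheet of μ3²−μ1²−μ2²=r² minus its axis point. *)

theory Defs
  imports "HOL-Analysis.Analysis"
begin

section \<open>Smooth maps\<close>

text \<open>On an open set, \<open>C_k\<close> is determined by iterated directional derivatives in finite
  dimension; all sets used below are open.\<close>

fun Ck_on :: "nat \<Rightarrow> ('a::euclidean_space \<Rightarrow> 'b::euclidean_space) \<Rightarrow> 'a set \<Rightarrow> bool" where
  "Ck_on 0 f S \<longleftrightarrow> continuous_on S f"
| "Ck_on (Suc k) f S \<longleftrightarrow>
     (\<forall>x\<in>S. f differentiable (at x)) \<and>
     (\<forall>v. Ck_on k (\<lambda>x. frechet_derivative f (at x) v) S)"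

definition smooth_on :: "('a::euclidean_space \<Rightarrow> 'b::euclidean_space) \<Rightarrow> 'a set \<Rightarrow> bool" where
  "smooth_on f S \<longleftrightarrow> (\<forall>k. Ck_on k f S)"


section \<open>Componentwise derivatives\<close>

lemma vec_sum_axis: "(x :: 'a::real_normed_vector ^ 'n) = (\<Sum>i\<in>UNIV. axis i (x $ i))"
  by (simp add: vec_eq_iff axis_def if_distrib cong: if_cong)

lemma bounded_linear_axis: "bounded_linear (axis i :: 'a::euclidean_space \<Rightarrow> 'a ^ 'n)"
  unfolding linear_conv_bounded_linear[symmetric]
  by (rule linearI) (auto simp: vec_eq_iff axis_def)

lemma has_derivative_vecI:
  fixes f :: "'b::real_normed_vector \<Rightarrow> 'a::euclidean_space ^ 'n"
  assumes "\<And>i. ((\<lambda>t. f t $ i) has_derivative (\<lambda>t. f' t $ i)) (at x)"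
  shows "(f has_derivative f') (at x)"
proof -
  have "((\<lambda>t. \<Sum>i\<in>UNIV. axis i (f t $ i) :: 'a^'n) has_derivative (\<lambda>t. \<Sum>i\<in>UNIV. axis i (f' t $ i))) (at x)"
    by (intro has_derivative_sum bounded_linear.has_derivative[OF bounded_linear_axis] assms)
  then show ?thesis by (simp flip: vec_sum_axis)
qed

lemma differentiable_vecI:
  fixes f :: "'b::real_normed_vector \<Rightarrow> 'a::euclidean_space ^ 'n"
  assumes "\<And>i. (\<lambda>t. f t $ i) differentiable (at x)"
  shows "f differentiable (at x)"
proof -
  from assms obtain g where "\<And>i. ((\<lambda>t. f t $ i) has_derivative g i) (at x)"
    unfolding differentiable_def by metis
  then have "(f has_derivative (\<lambda>t. \<chi> i. g i t)) (at x)"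
    by (intro has_derivative_vecI) simp
  then show ?thesis unfolding differentiable_def by blast
qed


section \<open>The punctured space and its symplectic and Poisson structures\<close>

definition Cx2 :: "(complex^2) set" where
  "Cx2 = {a. a$1 \<noteq> 0 \<and> a$2 \<noteq> 0}"

definition ksgn :: "2 \<Rightarrow> real" where
  "ksgn j = (if j = 1 then 1 else -1)"

text \<open>The value of \<open>-(i/2) \<Sum>j. k_j db_j \<and> d(cnj b_j)\<close> on tangent vectors, with
  \<open>(\<alpha> \<and> \<beta>)(v,w) = \<alpha>(v) \<beta>(w) - \<alpha>(w) \<beta>(v)\<close>. It is real (lemma below), whence the \<open>Re\<close>.\<close>

definition Omega_cx :: "complex^2 \<Rightarrow> complex^2 \<Rightarrow> complex" where
  "Omega_cx v w = -(\<i>/2) *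
     (\<Sum>j\<in>UNIV. complex_of_real (ksgn j) * (v$j * cnj (w$j) - w$j * cnj (v$j)))"

definition Omega :: "complex^2 \<Rightarrow> complex^2 \<Rightarrow> real" where
  "Omega v w = Re (Omega_cx v w)"

lemma Omega_cx_real: "complex_of_real (Omega v w) = Omega_cx v w"
  by (simp add: Omega_def Omega_cx_def sum_2 ksgn_def complex_eq_iff)

text \<open>Wirtinger derivatives of a real-valued function, from its real derivative.\<close>

definition wirt :: "2 \<Rightarrow> (complex^2 \<Rightarrow> real) \<Rightarrow> complex^2 \<Rightarrow> complex" where
  "wirt j F b =
     (complex_of_real (frechet_derivative F (at b) (axis j 1))
      - \<i> * complex_of_real (frechet_derivative F (at b) (axis j \<i>))) / 2"

definition wirt_bar :: "2 \<Rightarrow> (complex^2 \<Rightarrow> real) \<Rightarrow> complex^2 \<Rightarrow> complex" where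
  "wirt_bar j F b =
     (complex_of_real (frechet_derivative F (at b) (axis j 1))
      + \<i> * complex_of_real (frechet_derivative F (at b) (axis j \<i>))) / 2"

definition poisson_cx ::
  "(complex^2 \<Rightarrow> real) \<Rightarrow> (complex^2 \<Rightarrow> real) \<Rightarrow> complex^2 \<Rightarrow> complex" where
  "poisson_cx F G b = 2 * \<i> *
     (\<Sum>j\<in>UNIV. complex_of_real (ksgn j) *
        (wirt j F b * wirt_bar j G b - wirt j G b * wirt_bar j F b))"

definition poisson ::
  "(complex^2 \<Rightarrow> real) \<Rightarrow> (complex^2 \<Rightarrow> real) \<Rightarrow> complex^2 \<Rightarrow> real" where
  "poisson F G b = Re (poisson_cx F G b)"

lemma poisson_cx_real: "complex_of_real (poisson F G b) = poisson_cx F G b"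
  by (simp add: poisson_def poisson_cx_def sum_2 ksgn_def wirt_def wirt_bar_def complex_eq_iff
      algebra_simps)

definition zero_bracket :: "(real \<Rightarrow> real) \<Rightarrow> (real \<Rightarrow> real) \<Rightarrow> real \<Rightarrow> real" where
  "zero_bracket F G x = 0"

definition poisson_map ::
  "'a::euclidean_space set \<Rightarrow> (('a \<Rightarrow> real) \<Rightarrow> ('a \<Rightarrow> real) \<Rightarrow> 'a \<Rightarrow> real) \<Rightarrow>
   (('b::euclidean_space \<Rightarrow> real) \<Rightarrow> ('b \<Rightarrow> real) \<Rightarrow> 'b \<Rightarrow> real) \<Rightarrow> ('a \<Rightarrow> 'b) \<Rightarrow> bool" where
  "poisson_map S brS brT \<phi> \<longleftrightarrow>
     smooth_on \<phi> S \<and>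
     (\<forall>F G. smooth_on F UNIV \<and> smooth_on G UNIV \<longrightarrow>
        (\<forall>x\<in>S. brS (F \<circ> \<phi>) (G \<circ> \<phi>) x = brT F G (\<phi> x)))"


section \<open>SU(1,1), its Lie algebra, and the Lie--Poisson bracket\<close>

definition cadjoint :: "complex^2^2 \<Rightarrow> complex^2^2" where
  "cadjoint A = (\<chi> i j. cnj (A$j$i))"

definition Kmat :: "complex^2^2" where
  "Kmat = (\<chi> i j. if i = j then complex_of_real (ksgn i) else 0)"

definition SU11 :: "(complex^2^2) set" where
  "SU11 = {U. cadjoint U ** Kmat ** U = Kmat \<and> det U = 1}"

text \<open>The Lie algebra as the tangent space of \<open>SU11\<close> at the identity.\<close>

definition su11 :: "(complex^2^2) set" where
  "su11 = {\<xi>. \<exists>\<gamma>. (\<forall>t::real. \<gamma> t \<in> SU11) \<and> \<gamma> 0 = mat 1 \<and>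
                 (\<gamma> has_vector_derivative \<xi>) (at 0)}"

text \<open>The pairing is real on \<open>su11\<close> (lemma \<open>su11_pairing_hat\<close>), whence the \<open>Re\<close>.\<close>

definition su11_pairing :: "complex^2^2 \<Rightarrow> complex^2^2 \<Rightarrow> real" where
  "su11_pairing \<eta> \<xi> = Re (trace (cadjoint \<eta> ** \<xi>) / 2)"

definition commutator :: "complex^2^2 \<Rightarrow> complex^2^2 \<Rightarrow> complex^2^2" where
  "commutator A B = A ** B - B ** A"

text \<open>The identification of \<open>real^3\<close> with the dual of \<open>su11\<close> (itself identified with \<open>su11\<close>
  by the pairing). Functions on the dual are written as functions on \<open>real^3\<close>.\<close>

definition hat :: "real^3 \<Rightarrow> complex^2^2" where
  "hat \<mu> = vector
     [vector [\<i> * complex_of_real (\<mu>$3),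
              \<i> * (complex_of_real (\<mu>$1) - \<i> * complex_of_real (\<mu>$2))],
      vector [\<i> * -(complex_of_real (\<mu>$1) + \<i> * complex_of_real (\<mu>$2)),
              \<i> * -complex_of_real (\<mu>$3)]]"

lemma su11_pairing_hat:
  "trace (cadjoint (hat \<mu>) ** hat \<nu>) / 2 = complex_of_real (\<mu> \<bullet> \<nu>)"
  by (simp add: hat_def cadjoint_def matrix_matrix_mult_def sum_2 sum_3 trace_def inner_vec_def
      complex_eq_iff)

lemma su11_hat: "su11 = range hat"
proof
  show "su11 \<subseteq> range hat"
  proof
    fix \<xi> assume "\<xi> \<in> su11"
    then obtain \<gamma> where g: "\<And>t::real. \<gamma> t \<in> SU11" "\<gamma> 0 = mat 1" "(\<gamma> has_vector_derivative \<xi>) (at 0)"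
      unfolding su11_def by blast
    have c: "((\<lambda>t. \<gamma> t $ i $ j) has_vector_derivative \<xi> $ i $ j) (at 0)" for i j
      using bounded_linear.has_vector_derivative[OF bounded_linear_vec_nth
         bounded_linear.has_vector_derivative[OF bounded_linear_vec_nth g(3)]] .
    have cc: "((\<lambda>t. cnj (\<gamma> t $ i $ j)) has_vector_derivative cnj (\<xi> $ i $ j)) (at 0)" for i j
      using bounded_linear.has_vector_derivative[OF bounded_linear_cnj c] .
    have g0: "\<gamma> 0 $ 1 $ 1 = 1" "\<gamma> 0 $ 2 $ 2 = 1" "\<gamma> 0 $ 1 $ 2 = 0" "\<gamma> 0 $ 2 $ 1 = 0"
      by (simp_all add: g(2) mat_def)
    have e1: "(\<lambda>t. cnj (\<gamma> t $ 1 $ i) * \<gamma> t $ 1 $ j - cnj (\<gamma> t $ 2 $ i) * \<gamma> t $ 2 $ j) = (\<lambda>t. Kmat $ i $ j)" for i j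
    proof
      fix t
      have "(cadjoint (\<gamma> t) ** Kmat ** \<gamma> t) $ i $ j = Kmat $ i $ j" using g(1)[of t] by (simp add: SU11_def)
      then show "cnj (\<gamma> t $ 1 $ i) * \<gamma> t $ 1 $ j - cnj (\<gamma> t $ 2 $ i) * \<gamma> t $ 2 $ j = Kmat $ i $ j"
        by (simp add: cadjoint_def matrix_matrix_mult_def sum_2 Kmat_def ksgn_def)
    qed
    have e2: "(\<lambda>t. \<gamma> t $ 1 $ 1 * \<gamma> t $ 2 $ 2 - \<gamma> t $ 1 $ 2 * \<gamma> t $ 2 $ 1) = (\<lambda>t. 1)"
      using g(1) by (auto simp: SU11_def det_2)
    have d1: "(cnj (\<gamma> 0 $ 1 $ i) * \<xi> $ 1 $ j + cnj (\<xi> $ 1 $ i) * \<gamma> 0 $ 1 $ j)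
       - (cnj (\<gamma> 0 $ 2 $ i) * \<xi> $ 2 $ j + cnj (\<xi> $ 2 $ i) * \<gamma> 0 $ 2 $ j) = 0" for i j
      using has_vector_derivative_diff[OF has_vector_derivative_mult[OF cc[of 1 i] c[of 1 j]]
         has_vector_derivative_mult[OF cc[of 2 i] c[of 2 j]], unfolded e1]
      by (metis has_vector_derivative_const vector_derivative_unique_at)
    have d2: "(\<gamma> 0 $ 1 $ 1 * \<xi> $ 2 $ 2 + \<xi> $ 1 $ 1 * \<gamma> 0 $ 2 $ 2)
       - (\<gamma> 0 $ 1 $ 2 * \<xi> $ 2 $ 1 + \<xi> $ 1 $ 2 * \<gamma> 0 $ 2 $ 1) = 0"
      using has_vector_derivative_diff[OF has_vector_derivative_mult[OF c[of 1 1] c[of 2 2]]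
         has_vector_derivative_mult[OF c[of 1 2] c[of 2 1]], unfolded e2]
      by (metis has_vector_derivative_const vector_derivative_unique_at)
    have "\<xi> = hat (vector [Im (\<xi> $ 1 $ 2), Re (\<xi> $ 1 $ 2), Im (\<xi> $ 1 $ 1)])"
      using d1[of 1 1] d1[of 1 2] d1[of 2 2] d2
      by (simp add: hat_def vec_eq_iff forall_2 g0 complex_eq_iff)
    then show "\<xi> \<in> range hat" by blast
  qed
next
  show "range hat \<subseteq> su11"
  proof clarify
    fix \<mu> :: "real^3"
    define \<beta> where "\<beta> = \<i> * (complex_of_real (\<mu>$1) - \<i> * complex_of_real (\<mu>$2))"
    define \<alpha> where "\<alpha> t = exp (\<i> * complex_of_real (\<mu>$3 * t)) * complex_of_real (sqrt (1 + t\<^sup>2 * (cmod \<beta>)\<^sup>2))" for t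
    define \<gamma> :: "real \<Rightarrow> complex^2^2" where "\<gamma> t = vector [vector [\<alpha> t, of_real t * \<beta>], vector [of_real t * cnj \<beta>, cnj (\<alpha> t)]]" for t
    have nz: "cmod (\<alpha> t) ^ 2 = 1 + t\<^sup>2 * (cmod \<beta>)\<^sup>2" for t
      by (simp add: \<alpha>_def norm_mult power_mult_distrib)
    have aa: "\<alpha> t * cnj (\<alpha> t) = 1 + t\<^sup>2 * (\<beta> * cnj \<beta>)" for t
      by (simp flip: complex_norm_square add: nz)
    have "\<gamma> t \<in> SU11" for t
      using aa[of t]
      by (simp add: SU11_def \<gamma>_def det_2 vec_eq_iff forall_2 cadjoint_def matrix_matrix_mult_def sum_2 Kmat_def ksgn_def)
        (simp add: algebra_simps power2_eq_square)
    moreover have "\<gamma> 0 = mat 1" by (simp add: \<gamma>_def \<alpha>_def mat_def vec_eq_iff forall_2)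
    moreover have "(\<gamma> has_vector_derivative hat \<mu>) (at 0)"
    proof -
      have da: "(\<alpha> has_vector_derivative \<i> * complex_of_real (\<mu>$3)) (at 0)"
      proof -
        have 1: "((\<lambda>t. exp (\<i> * complex_of_real (\<mu>$3 * t))) has_vector_derivative \<i> * complex_of_real (\<mu>$3)) (at 0)"
          unfolding of_real_mult
          by (rule has_vector_derivative_real_field[of "\<lambda>z. exp (\<i> * (complex_of_real (\<mu>$3) * z))"])
             (auto intro!: derivative_eq_intros)
        have "((\<lambda>t. sqrt (1 + t\<^sup>2 * (cmod \<beta>)\<^sup>2)) has_vector_derivative 0) (at 0)"
          by (auto intro!: derivative_eq_intros simp flip: has_real_derivative_iff_has_vector_derivative)
        from has_vector_derivative_mult[OF 1 bounded_linear.has_vector_derivative[OF bounded_linear_of_real this]]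
        show ?thesis unfolding \<alpha>_def by simp
      qed
      have dc: "((\<lambda>t. cnj (\<alpha> t)) has_vector_derivative cnj (\<i> * complex_of_real (\<mu>$3))) (at 0)"
        by (rule bounded_linear.has_vector_derivative[OF bounded_linear_cnj da])
      have db: "((\<lambda>t. of_real t * c) has_vector_derivative c) (at 0)" for c :: complex
        by (auto intro!: derivative_eq_intros simp: has_vector_derivative_def scaleR_conv_of_real)
      have "((\<lambda>t. \<gamma> t $ i $ j) has_vector_derivative hat \<mu> $ i $ j) (at 0)" for i j
        using exhaust_2[of i] exhaust_2[of j] da dc db[of \<beta>] db[of "cnj \<beta>"]
        by (auto simp: \<gamma>_def hat_def \<beta>_def algebra_simps)
      then show ?thesis unfolding has_vector_derivative_def
        by (intro has_derivative_vecI) simp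
    qed
    ultimately show "hat \<mu> \<in> su11" unfolding su11_def by blast
  qed
qed

definition fun_deriv :: "(real^3 \<Rightarrow> real) \<Rightarrow> real^3 \<Rightarrow> complex^2^2" where
  "fun_deriv F \<mu> =
     (THE \<xi>. \<xi> \<in> su11 \<and>
        (\<forall>\<delta>. su11_pairing (hat \<delta>) \<xi> = frechet_derivative F (at \<mu>) \<delta>))"

definition lie_poisson_plus ::
  "(real^3 \<Rightarrow> real) \<Rightarrow> (real^3 \<Rightarrow> real) \<Rightarrow> real^3 \<Rightarrow> real" where
  "lie_poisson_plus F G \<mu> =
     su11_pairing (hat \<mu>) (commutator (fun_deriv F \<mu>) (fun_deriv G \<mu>))"


section \<open>The resonance maps\<close>

definition fres :: "nat \<Rightarrow> nat \<Rightarrow> complex^2 \<Rightarrow> complex^2" where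
  "fres n m a = vector
     [(a$1)^m / complex_of_real (sqrt (real m) * cmod (a$1)^(m - 1)),
      (a$2)^n / complex_of_real (sqrt (real n) * cmod (a$2)^(n - 1))]"

definition Rres :: "nat \<Rightarrow> nat \<Rightarrow> complex^2 \<Rightarrow> real" where
  "Rres n m a = ((cmod (a$1))^2 / real m - (cmod (a$2))^2 / real n) / 2"

text \<open>Coordinate form of the momentum map; see \<open>hat_J11\<close> for the matrix form.\<close>

definition J11 :: "complex^2 \<Rightarrow> real^3" where
  "J11 b = vector [Re (b$1 * cnj (b$2)), - Im (b$1 * cnj (b$2)),
                   ((cmod (b$1))^2 + (cmod (b$2))^2) / 2]"

definition Jres :: "nat \<Rightarrow> nat \<Rightarrow> complex^2 \<Rightarrow> real^3" where
  "Jres n m = J11 \<circ> fres n m"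

lemma fres_Cx2: "a \<in> Cx2 \<Longrightarrow> n > 0 \<Longrightarrow> m > 0 \<Longrightarrow> fres n m a \<in> Cx2"
  by (simp add: Cx2_def fres_def)

lemma Jres_1_1: "Jres 1 1 = J11"
  by (simp add: Jres_def fres_def fun_eq_iff J11_def)

definition outer :: "complex^2 \<Rightarrow> complex^2^2" where
  "outer b = (\<chi> i j. b$i * cnj (b$j))"

lemma hat_J11:
  "hat (J11 b) =
     (\<chi> i j. \<i> * ((Kmat ** outer b - (\<chi> p q. trace (Kmat ** outer b) / 2 * mat 1 $ p $ q)) $ i $ j))"
  by (simp add: vec_eq_iff forall_2 hat_def J11_def Kmat_def outer_def matrix_matrix_mult_def
      sum_2 ksgn_def trace_def mat_def complex_eq_iff cmod_power2)
    (simp add: field_simps power2_eq_square)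

section \<open>Dual pairs\<close>

definition kerT :: "('a::euclidean_space \<Rightarrow> 'b::euclidean_space) \<Rightarrow> 'a \<Rightarrow> 'a set" where
  "kerT \<phi> a = {v. frechet_derivative \<phi> (at a) v = 0}"

definition symp_orth :: "(complex^2) set \<Rightarrow> (complex^2) set" where
  "symp_orth V = {v. \<forall>w\<in>V. Omega v w = 0}"

definition dual_pair_at ::
  "(complex^2 \<Rightarrow> 'b::euclidean_space) \<Rightarrow> (complex^2 \<Rightarrow> 'c::euclidean_space) \<Rightarrow> complex^2 \<Rightarrow> bool" where
  "dual_pair_at R J a \<longleftrightarrow>
     symp_orth (kerT R a) = kerT J a \<and> symp_orth (kerT J a) = kerT R a"

text \<open>On the null cone \<open>R = 0\<close> the image of \<open>J\<close> touches the boundary cone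
  \<open>\<mu>3^2 = \<mu>1^2 + \<mu>2^2\<close>, so \<open>J\<close> drops rank and \<open>ker TJ\<close> is two-dimensional, while the
  symplectic complement of the hyperplane \<open>ker TR\<close> is a line. Hence the two kernels are never
  symplectic complements there (\<open>null_not_dual_pair\<close>), and the complementarity has to be
  asserted at points with \<open>R \<noteq> 0\<close> only.\<close>

lemma Rres_has_derivative:
  "(Rres n m has_derivative (\<lambda>v. (a$1) \<bullet> (v$1) / real m - (a$2) \<bullet> (v$2) / real n)) (at a)"
proof -
  have "Rres n m = (\<lambda>a. ((a$1 \<bullet> a$1) / real m - (a$2 \<bullet> a$2) / real n) / 2)"
    by (simp add: Rres_def power2_norm_eq_inner fun_eq_iff)
  moreover have d: "((\<lambda>x. x $ i \<bullet> x $ i) has_derivative (\<lambda>v. a $ i \<bullet> v $ i + v $ i \<bullet> a $ i)) (at a)" for i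
    by (intro has_derivative_inner bounded_linear_imp_has_derivative bounded_linear_vec_nth)
  moreover have "((\<lambda>a. ((a$1 \<bullet> a$1) / real m - (a$2 \<bullet> a$2) / real n) / 2) has_derivative
      (\<lambda>v. ((a$1 \<bullet> v$1 + v$1 \<bullet> a$1) / real m - (a$2 \<bullet> v$2 + v$2 \<bullet> a$2) / real n) / 2)) (at a)"
    unfolding divide_inverse
    by (intro has_derivative_mult_left has_derivative_diff d)
  ultimately show ?thesis
    by (simp add: inner_commute diff_divide_distrib)
qed

lemma Jres_differentiable:
  assumes "n > 0" "m > 0" "a \<in> Cx2"
  shows "Jres n m differentiable (at a)"
proof -
  have nth: "(\<lambda>x::complex^2. x $ i) differentiable (at a)" for i
    by (intro bounded_linear_imp_differentiable bounded_linear_vec_nth)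
  have n0: "(\<lambda>x. norm (x $ i)) differentiable (at a)" if "a $ i \<noteq> 0" for i
    using differentiable_chain_at[OF nth[of i] differentiable_norm_at[OF that]] by (simp add: o_def)
  have nn: "(\<lambda>x. complex_of_real (norm (x $ i))) differentiable (at a)" if "a $ i \<noteq> 0" for i
    by (rule differentiable_compose[OF bounded_linear_imp_differentiable[OF bounded_linear_of_real]]) (rule n0[OF that])
  have p1: "(\<lambda>x. fres n m x $ 1) differentiable (at a)"
    unfolding fres_def vector_2 of_real_mult of_real_power using assms
    by (intro differentiable_divide differentiable_power differentiable_mult differentiable_const nth nn)
       (auto simp: Cx2_def)
  have p2: "(\<lambda>x. fres n m x $ 2) differentiable (at a)"
    unfolding fres_def vector_2 of_real_mult of_real_power using assms
    by (intro differentiable_divide differentiable_power differentiable_mult differentiable_const nth nn)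
       (auto simp: Cx2_def)
  have p: "(\<lambda>x. fres n m x $ i) differentiable (at a)" for i
    using exhaust_2[of i] p1 p2 by auto
  have q1: "(\<lambda>x. Re (fres n m x $ i)) differentiable (at a)" for i
    by (rule differentiable_compose[OF bounded_linear_imp_differentiable[OF bounded_linear_Re] p])
  have q2: "(\<lambda>x. Im (fres n m x $ i)) differentiable (at a)" for i
    by (rule differentiable_compose[OF bounded_linear_imp_differentiable[OF bounded_linear_Im] p])
  have "(\<lambda>x. Jres n m x $ i) differentiable (at a)" for i
  proof -
    let ?r = "\<lambda>i x. Re (fres n m x $ i)" and ?s = "\<lambda>i x. Im (fres n m x $ i)"
    have "(\<lambda>x. ?r 1 x * ?r 2 x + ?s 1 x * ?s 2 x) differentiable (at a)"
      "(\<lambda>x. ?r 1 x * ?s 2 x - ?s 1 x * ?r 2 x) differentiable (at a)"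
      by (intro differentiable_add differentiable_diff differentiable_mult q1 q2)+
    moreover have "(\<lambda>x. ((cmod (fres n m x $ 1))^2 + (cmod (fres n m x $ 2))^2) / 2) differentiable (at a)"
      unfolding cmod_power2 unfolding power2_eq_square divide_inverse
      by (intro differentiable_add differentiable_mult differentiable_const q1 q2)
    ultimately show ?thesis
      using exhaust_3[of i] by (auto simp: Jres_def J11_def)
  qed
  then show ?thesis by (rule differentiable_vecI)
qed

lemma null_not_dual_pair:
  assumes "n > 0" "m > 0" "a \<in> Cx2" "Rres n m a = 0"
  shows "\<not> dual_pair_at (Rres n m) (Jres n m) a"
proof
  assume dp: "dual_pair_at (Rres n m) (Jres n m) a"
  define v :: "complex^2" where "v = vector [a$1, -(a$2)]"
  define b where "b = fres n m a"
  have a: "a$1 \<noteq> 0" "a$2 \<noteq> 0" using assms by (auto simp: Cx2_def)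
  have DR: "frechet_derivative (Rres n m) (at a) = (\<lambda>v. (a$1) \<bullet> (v$1) / real m - (a$2) \<bullet> (v$2) / real n)"
    by (rule frechet_derivative_at[OF Rres_has_derivative, symmetric])
  have pw: "cmod (z ^ k / complex_of_real (sqrt (real k) * cmod z ^ (k - 1))) ^ 2 = (cmod z)^2 / real k"
    if "z \<noteq> 0" "k > 0" for z k
    using that by (cases k) (auto simp: norm_divide norm_mult norm_power power_divide power_mult_distrib power2_eq_square field_simps)
  have nb: "(cmod (b$1))^2 = (cmod (b$2))^2"
    using assms(4) pw[OF a(1) assms(2)] pw[OF a(2) assms(1)]
    by (simp add: b_def fres_def Rres_def)
  have DJ: "(Jres n m has_derivative frechet_derivative (Jres n m) (at a)) (at a)"
    using Jres_differentiable[OF assms(1-3)] frechet_derivative_works by blast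
  have sc: "((1 + complex_of_real s) * z) ^ k / complex_of_real (sqrt (real k) * cmod ((1 + complex_of_real s) * z) ^ (k - 1)) =
      (1 + complex_of_real s) * (z ^ k / complex_of_real (sqrt (real k) * cmod z ^ (k - 1)))"
    if "\<bar>s\<bar> < 1" "k > 0" for z :: complex and k :: nat and s :: real
  proof -
    obtain l where k: "k = Suc l" using \<open>k > 0\<close> by (cases k) auto
    have 1: "cmod (1 + complex_of_real s) = 1 + s"
      using that by (metis abs_of_pos norm_of_real of_real_1 of_real_add abs_less_iff add.commute diff_gt_0_iff_gt diff_minus_eq_add)
    have 2: "1 + complex_of_real s \<noteq> 0" using 1 that by auto
    have 3: "cmod ((1 + complex_of_real s) * z) = (1 + s) * cmod z" by (simp add: norm_mult 1)
    have "((1 + complex_of_real s) * z) ^ k / complex_of_real (sqrt (real k) * cmod ((1 + complex_of_real s) * z) ^ (k - 1)) =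
      ((1 + complex_of_real s) * z) * (((1 + complex_of_real s) * z) ^ l / ((1 + complex_of_real s) ^ l * complex_of_real (sqrt (real k) * cmod z ^ l)))"
      unfolding 3 by (simp add: k power_mult_distrib mult_ac)
    also have "\<dots> = ((1 + complex_of_real s) * z) * (z ^ l / complex_of_real (sqrt (real k) * cmod z ^ l))"
      using 2 by (simp add: power_mult_distrib)
    finally show ?thesis by (simp add: k)
  qed
  have F: "fres n m (a + t *\<^sub>R v) = vector [(1 + complex_of_real t) * b$1, (1 - complex_of_real t) * b$2]" if "\<bar>t\<bar> < 1" for t
  proof -
    have av: "(a + t *\<^sub>R v) $ 1 = (1 + complex_of_real t) * a$1"
      "(a + t *\<^sub>R v) $ 2 = (1 + complex_of_real (- t)) * a$2"
      unfolding v_def by (simp_all add: scaleR_conv_of_real[where 'a=complex] algebra_simps)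
    have t: "\<bar>- t\<bar> < 1" using that by simp
    show ?thesis
      unfolding b_def fres_def av sc[OF that assms(2)] sc[OF t assms(1)] vector_2 by simp
  qed
  have JJ: "Jres n m (a + t *\<^sub>R v) = vector [(1 - t^2) * Re (b$1 * cnj (b$2)), - ((1 - t^2) * Im (b$1 * cnj (b$2))), (1 + t^2) * (cmod (b$1))^2]"
    if "\<bar>t\<bar> < 1" for t
  proof -
    have cm: "cmod (1 + complex_of_real t) = 1 + t" "cmod (1 - complex_of_real t) = 1 - t"
      using that norm_of_real[of "1 + t", where 'a=complex] norm_of_real[of "1 - t", where 'a=complex]
      by simp_all
    have c1: "(1 + complex_of_real t) * b$1 * cnj ((1 - complex_of_real t) * b$2)
        = complex_of_real (1 - t^2) * (b$1 * cnj (b$2))"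
      by (simp add: algebra_simps power2_eq_square)
    have c3: "((cmod ((1 + complex_of_real t) * b$1))^2 + (cmod ((1 - complex_of_real t) * b$2))^2) / 2
        = (1 + t^2) * (cmod (b$1))^2"
      unfolding norm_mult power_mult_distrib cm nb[symmetric]
      by (simp add: power2_eq_square field_simps)
    show ?thesis
      unfolding Jres_def comp_apply F[OF that] J11_def vector_2 c1 c3 by simp
  qed
  have "((\<lambda>t::real. vector [(1 - t^2) * Re (b$1 * cnj (b$2)), - ((1 - t^2) * Im (b$1 * cnj (b$2))), (1 + t^2) * (cmod (b$1))^2] :: real^3)
     has_derivative (\<lambda>t. 0)) (at 0)"
  proof (rule has_derivative_vecI)
    fix i :: 3
    show "((\<lambda>t::real. (vector [(1 - t^2) * Re (b$1 * cnj (b$2)), - ((1 - t^2) * Im (b$1 * cnj (b$2))), (1 + t^2) * (cmod (b$1))^2] :: real^3) $ i)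
     has_derivative (\<lambda>t. 0 $ i)) (at 0)"
      using exhaust_3[of i] by (auto intro!: derivative_eq_intros)
  qed
  then have 1: "((\<lambda>t. Jres n m (a + t *\<^sub>R v)) has_derivative (\<lambda>t. 0)) (at 0)"
    by (rule has_derivative_transform_within_open[of _ _ _ _ "{-1<..<1}"]) (auto simp: JJ)
  have 2: "((\<lambda>t. Jres n m (a + t *\<^sub>R v)) has_derivative (\<lambda>t. frechet_derivative (Jres n m) (at a) (t *\<^sub>R v))) (at 0)"
    by (rule has_derivative_compose[of "\<lambda>t. a + t *\<^sub>R v" "\<lambda>t. t *\<^sub>R v" 0 UNIV])
      (auto intro!: derivative_eq_intros DJ)
  have "frechet_derivative (Jres n m) (at a) v = 0"
    using fun_cong[OF has_derivative_unique[OF 1 2], of 1] by simp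
  then have "v \<in> symp_orth (kerT (Rres n m) a)" using dp by (auto simp: dual_pair_at_def kerT_def)
  moreover have "vector [\<i> * a$1, 0] \<in> kerT (Rres n m) a"
    by (simp add: kerT_def DR inner_complex_def)
  ultimately have "Omega v (vector [\<i> * a$1, 0]) = 0" by (auto simp: symp_orth_def)
  moreover have "Omega v (vector [\<i> * a$1, 0]) = - ((Re (a$1))^2 + (Im (a$1))^2)"
    by (simp add: Omega_def Omega_cx_def sum_2 ksgn_def v_def power2_eq_square)
  ultimately have "(Re (a$1))^2 + (Im (a$1))^2 = 0" by linarith
  then have "a$1 = 0" unfolding sum_power2_eq_zero_iff by (simp add: complex_eq_iff)
  then show False using a(1) by simp
qed

text \<open>The Kummer shape at level \<open>r\<close>: the bowl-shaped upper sheet of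
  \<open>\<mu>3^2 - \<mu>1^2 - \<mu>2^2 = r^2\<close>. Its axis point is missing from the image because
  \<open>\<mu>1^2 + \<mu>2^2 = |b1|^2 |b2|^2\<close> and both coordinates are nonzero.\<close>

definition kummer_sheet :: "real \<Rightarrow> (real^3) set" where
  "kummer_sheet r =
     {\<mu>. \<mu>$3 > 0 \<and> (\<mu>$3)^2 - (\<mu>$1)^2 - (\<mu>$2)^2 = r^2 \<and> (\<mu>$1 \<noteq> 0 \<or> \<mu>$2 \<noteq> 0)}"

end

theory Submission
  imports Defs
begin

text \<open>Everything becomes elementary in the radial and angular directions at a point. Write a
  tangent vector at \<open>a\<close> as \<open>v$j = a$j * (s_j + \<i> t_j)\<close>, so that \<open>s_j\<close> is the relative change of
  modulus and \<open>t_j\<close> the change of argument, and put \<open>p = |a$1|^2 / m\<close>, \<open>q = |a$2|^2 / n\<close>. The map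
  \<open>fres n m\<close> multiplies the arguments by \<open>m\<close> and \<open>n\<close> and divides the squared moduli by the same
  numbers (\<open>res_pow_has_derivative\<close>, \<open>norm_res_pow_sq\<close>), hence preserves area in each factor. With
  \<open>S = s_1 + s_2\<close> and \<open>T = m t_1 - n t_2\<close> one finds, for \<open>\<mu> = Jres n m a\<close>,
  \<^item> \<open>dR = p s_1 - q s_2\<close>,
  \<^item> \<open>dJ = (\<mu>1 S + \<mu>2 T, \<mu>2 S - \<mu>1 T, p s_1 + q s_2)\<close> (\<open>Jres_has_derivative\<close>),
  \<^item> \<open>\<Omega>(v, v') = m p (t_1 s'_1 - s_1 t'_1) - n q (t_2 s'_2 - s_2 t'_2)\<close> (\<open>Omega_polar\<close>),
  \<^item> \<open>\<mu>1^2 + \<mu>2^2 = p q\<close>, \<open>\<mu>3 = (p + q) / 2\<close> and \<open>R = (p - q) / 2\<close>.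

  The last line gives the paraboloid \<open>\<mu>3^2 - \<mu>1^2 - \<mu>2^2 = R^2\<close>, and any \<open>\<mu>\<close> on the sheet is
  reached because it determines the two moduli and one relative phase, and \<open>fres n m\<close> is onto.

  Poisson property: the bracket can be evaluated in the polar frame (\<open>poisson_polar\<close>), where it
  is a \<open>2 \<times> 2\<close> determinant for each factor; for \<open>J\<close> the weights \<open>m\<close>, \<open>n\<close> cancel and
  the structure constants of \<open>su(1,1)\<close> appear.

  Dual pair: the complement of the hyperplane \<open>ker dR\<close> is the line \<open>s_1 = s_2 = 0, T = 0\<close>
  spanned by the Hamiltonian direction of \<open>R\<close>. As \<open>p q \<noteq> 0\<close>, the first two components of \<open>dJ\<close>
  vanish exactly when \<open>S = T = 0\<close>, and then the third is \<open>2 R s_1\<close>. So \<open>ker dJ\<close> always contains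
  that line, and equals it where \<open>R \<noteq> 0\<close>.\<close>


section \<open>Closure properties of smooth maps\<close>

lemma Ck_on_cong:
  assumes "open S" and "\<And>x. x \<in> S \<Longrightarrow> f x = g x" and "Ck_on k f S"
  shows "Ck_on k g S"
  using assms(2,3)
proof (induction k arbitrary: f g)
  case 0
  then show ?case by (simp cong: continuous_on_cong)
next
  case (Suc k)
  have d: "(g has_derivative frechet_derivative f (at x)) (at x)" if "x \<in> S" for x
    by (rule has_derivative_transform_within_open[of f _ _ _ S])
       (use Suc.prems that \<open>open S\<close> in \<open>auto simp: frechet_derivative_works\<close>)
  have "frechet_derivative f (at x) = frechet_derivative g (at x)" if "x \<in> S" for x
    using frechet_derivative_at[OF d[OF that]] .
  with Suc.prems have "Ck_on k (\<lambda>x. frechet_derivative g (at x) v) S" for v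
    using Suc.IH[of "\<lambda>x. frechet_derivative f (at x) v"] by simp
  then show ?case using d by (auto simp: differentiable_def)
qed

text \<open>\<open>Ck_on\<close> refers to \<open>frechet_derivative\<close>, which carries no information outside points of
  differentiability; the next rule accepts instead any explicit formula for the derivative on the
  open set, so that the closure properties follow by induction on \<open>k\<close>.\<close>

lemma Ck_on_SucI:
  assumes "open S" and "\<And>x. x \<in> S \<Longrightarrow> (f has_derivative f' x) (at x)"
    and "\<And>v. Ck_on k (\<lambda>x. f' x v) S"
  shows "Ck_on (Suc k) f S"
proof -
  have "f' x = frechet_derivative f (at x)" if "x \<in> S" for x
    using frechet_derivative_at[OF assms(2)[OF that]] .
  then have "Ck_on k (\<lambda>x. frechet_derivative f (at x) v) S" for v
    using Ck_on_cong[OF \<open>open S\<close> _ assms(3)[of v], of "\<lambda>x. frechet_derivative f (at x) v"] by simp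
  then show ?thesis using assms(2) by (auto simp: differentiable_def)
qed

lemma Ck_on_Suc_has_derivative:
  assumes "Ck_on (Suc k) f S" "x \<in> S"
  shows "(f has_derivative frechet_derivative f (at x)) (at x)"
  using assms by (auto simp: frechet_derivative_works)

lemma Ck_on_SucD:
  assumes "Ck_on (Suc k) f S"
  shows "Ck_on k f S"
  using assms
proof (induction k arbitrary: f)
  case 0
  then have "\<forall>x\<in>S. isCont f x"
    by (auto intro: differentiable_imp_continuous_within)
  then show ?case by (simp add: continuous_at_imp_continuous_on)
next
  case (Suc k)
  have D: "(\<forall>x\<in>S. f differentiable at x) \<and>
      (\<forall>v. Ck_on (Suc k) (\<lambda>x. frechet_derivative f (at x) v) S)"
    using Suc.prems by (rule iffD1[OF Ck_on.simps(2)])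
  then have "f differentiable (at x)" if "x \<in> S" for x
    using that by (rule conjunct1[THEN bspec])
  moreover have "Ck_on k (\<lambda>x. frechet_derivative f (at x) v) S" for v
    using D[THEN conjunct2, THEN spec] by (rule Suc.IH)
  ultimately show ?case by simp
qed

lemma Ck_on_const:
  fixes S :: "'a::euclidean_space set"
  assumes "open S" shows "Ck_on k (\<lambda>x. c) S"
proof (induction k arbitrary: c)
  case (Suc k)
  show ?case by (rule Ck_on_SucI[where f' = "\<lambda>x v. 0"]) (auto intro: assms Suc)
qed simp

lemma Ck_on_add:
  assumes "open S" "Ck_on k f S" "Ck_on k g S"
  shows "Ck_on k (\<lambda>x. f x + g x) S"
  using assms(2,3)
proof (induction k arbitrary: f g)
  case (Suc k)
  show ?case
    using \<open>open S\<close> has_derivative_add[OF Suc.prems[THEN Ck_on_Suc_has_derivative]]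
    by (rule Ck_on_SucI) (use Suc in auto)
qed (simp add: continuous_on_add)

lemma Ck_on_sum:
  assumes "open S" "\<And>i. i \<in> I \<Longrightarrow> Ck_on k (f i) S"
  shows "Ck_on k (\<lambda>x. \<Sum>i\<in>I. f i x) S"
  using assms(2)
proof (induction I rule: infinite_finite_induct)
qed (simp_all add: Ck_on_add Ck_on_const \<open>open S\<close>)

lemma Ck_on_bounded_linear:
  assumes "bounded_linear L" "open S" "Ck_on k f S"
  shows "Ck_on k (\<lambda>x. L (f x)) S"
  using assms(3)
proof (induction k arbitrary: f)
  case (Suc k)
  show ?case
    using \<open>open S\<close> bounded_linear.has_derivative[OF assms(1) Suc.prems[THEN Ck_on_Suc_has_derivative]]
    by (rule Ck_on_SucI) (use Suc in auto)
qed (simp add: bounded_linear.continuous_on[OF assms(1)])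

lemmas Ck_on_minus = Ck_on_bounded_linear[OF bounded_linear_minus[OF bounded_linear_ident]]

lemma Ck_on_bounded_bilinear:
  assumes "bounded_bilinear B" "open S" "Ck_on k f S" "Ck_on k g S"
  shows "Ck_on k (\<lambda>x. B (f x) (g x)) S"
  using assms(3,4)
proof (induction k arbitrary: f g)
  case (Suc k)
  have "Ck_on k f S" "Ck_on k g S" using Suc.prems by (auto intro: Ck_on_SucD)
  then show ?case
    using \<open>open S\<close> bounded_bilinear.FDERIV[OF assms(1) Suc.prems[THEN Ck_on_Suc_has_derivative]]
    by (intro Ck_on_SucI) (use Suc in \<open>auto intro!: Ck_on_add\<close>)
qed (simp add: bounded_bilinear.continuous_on[OF assms(1)])

lemma Ck_on_id:
  fixes S :: "'a::euclidean_space set"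
  assumes "open S" shows "Ck_on k (\<lambda>x. x) S"
proof (cases k)
  case (Suc l)
  then show ?thesis using assms by (auto intro!: Ck_on_SucI Ck_on_const)
qed simp

lemmas Ck_on_mult = Ck_on_bounded_bilinear[OF bounded_bilinear_mult]

lemma Ck_on_power:
  fixes f :: "'a::euclidean_space \<Rightarrow> 'b::{euclidean_space,real_normed_algebra_1}"
  assumes "open S" "Ck_on k f S"
  shows "Ck_on k (\<lambda>x. f x ^ j) S"
  by (induction j) (simp_all add: Ck_on_const Ck_on_mult assms)

text \<open>The derivative of \<open>1/|f|\<close> is \<open>- (1/|f|)^3 (f \<bullet> f')\<close>, a product in which \<open>f\<close>, \<open>f'\<close>
  and, by induction, \<open>1/|f|\<close> are all \<open>C_k\<close>; so square roots and reciprocals need no separate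
  treatment.\<close>

lemma Ck_on_inverse_norm:
  fixes f :: "'a::euclidean_space \<Rightarrow> 'b::euclidean_space"
  assumes "open S" "\<And>x. x \<in> S \<Longrightarrow> f x \<noteq> 0" "Ck_on k f S"
  shows "Ck_on k (\<lambda>x. inverse (norm (f x))) S"
  using assms(3)
proof (induction k)
  case 0
  then show ?case using assms(2) by (auto intro!: continuous_intros)
next
  case (Suc k)
  note f = Ck_on_SucD[OF Suc.prems]
  have d: "((\<lambda>x. inverse (norm (f x))) has_derivative
      (\<lambda>v. - (inverse (norm (f x)) ^ 3 * (f x \<bullet> frechet_derivative f (at x) v)))) (at x)"
    if "x \<in> S" for x
  proof -
    have n: "(norm has_derivative (\<lambda>w. w \<bullet> sgn (f x))) (at (f x))"
      by (rule has_derivative_norm) (use assms(2) that in auto)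
    show ?thesis
      by (rule has_derivative_eq_rhs[OF Deriv.has_derivative_inverse[OF _
            has_derivative_compose[OF Ck_on_Suc_has_derivative[OF Suc.prems that] n]]])
         (use assms(2)[OF that] in
           \<open>auto simp: sgn_div_norm fun_eq_iff power3_eq_cube inner_commute\<close>)
  qed
  show ?case
    using \<open>open S\<close> d
    by (rule Ck_on_SucI)
       (use Suc f \<open>open S\<close> in \<open>auto intro!: Ck_on_minus Ck_on_mult Ck_on_power
          Ck_on_bounded_bilinear[OF bounded_bilinear_inner]\<close>)
qed

lemma Ck_on_vecI:
  fixes f :: "'a::euclidean_space \<Rightarrow> 'b::euclidean_space ^ 'n"
  assumes "open S" "\<And>i. Ck_on k (\<lambda>x. f x $ i) S"
  shows "Ck_on k f S"
proof -
  have "Ck_on k (\<lambda>x. \<Sum>i\<in>UNIV. axis i (f x $ i)) S"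
    by (intro Ck_on_sum Ck_on_bounded_linear[OF bounded_linear_axis] assms)
  then show ?thesis by (simp flip: vec_sum_axis)
qed



section \<open>The resonance map in logarithmic coordinates\<close>

lemma open_Cx2: "open Cx2"
proof -
  have "open ({a::complex^2. a$1 \<noteq> 0} \<inter> {a. a$2 \<noteq> 0})"
    by (intro open_Int open_Collect_neq continuous_intros)
  also have "{a. a$1 \<noteq> 0} \<inter> {a. a$2 \<noteq> 0} = Cx2" by (auto simp: Cx2_def)
  finally show ?thesis .
qed

definition res_pow :: "nat \<Rightarrow> complex \<Rightarrow> complex" where
  "res_pow k z = z ^ k / complex_of_real (sqrt (real k) * cmod z ^ (k - 1))"

lemma fres_nth [simp]: "fres n m a $ 1 = res_pow m (a$1)" "fres n m a $ 2 = res_pow n (a$2)"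
  by (simp_all add: fres_def res_pow_def)

lemma res_pow_eq:
  "res_pow k z = z ^ k * of_real (inverse (norm z)) ^ (k - 1) * of_real (inverse (sqrt k))"
  by (simp add: res_pow_def divide_inverse power_inverse flip: of_real_power)

lemma Ck_on_res_pow:
  assumes "open S" "\<And>x. x \<in> S \<Longrightarrow> f x \<noteq> 0" "Ck_on k f S"
  shows "Ck_on k (\<lambda>x. res_pow j (f x)) S"
  unfolding res_pow_eq
  by (intro Ck_on_mult Ck_on_power Ck_on_const Ck_on_bounded_linear[OF bounded_linear_of_real]
      Ck_on_inverse_norm assms)

lemma norm_res_pow:
  assumes "z \<noteq> 0" "k > 0"
  shows "cmod (res_pow k z) = cmod z / sqrt k"
  using assms by (cases k) (auto simp: res_pow_def norm_divide norm_mult norm_power)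

lemma norm_res_pow_sq:
  assumes "z \<noteq> 0" "k > 0"
  shows "(cmod (res_pow k z))\<^sup>2 = (cmod z)\<^sup>2 / k"
  using assms by (simp add: norm_res_pow power_divide)

lemma inverse_norm_power_has_derivative:
  fixes z :: complex
  assumes "z \<noteq> 0"
  shows "((\<lambda>z. inverse (norm z) ^ l) has_derivative
     (\<lambda>v. - (real l * inverse (norm z) ^ l * Re (v / z)))) (at z)"
proof -
  have n: "(norm has_derivative (\<lambda>w. w \<bullet> sgn z)) (at z)"
    by (rule has_derivative_norm) (use assms in auto)
  have Re: "Re (v / z) = (Re v * Re z + Im v * Im z) / (cmod z)\<^sup>2" for v
    by (simp add: Re_divide cmod_power2)
  have r: "v \<bullet> sgn z = cmod z * Re (v / z)" for v
    using assms unfolding Re by (simp add: sgn_div_norm inner_complex_def power2_eq_square field_simps)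
  have "((\<lambda>z. inverse (norm z)) has_derivative (\<lambda>v. - (inverse (norm z) * Re (v / z)))) (at z)"
    using Deriv.has_derivative_inverse[OF _ n] assms by (simp add: r field_simps)
  from has_derivative_power[OF this, of l] show ?thesis
    by (cases l) (simp_all add: algebra_simps)
qed

text \<open>In the logarithmic coordinate \<open>w = v / z\<close>, whose real part is the relative change of
  modulus and whose imaginary part is the change of argument, raising to the \<open>k\<close>-th power
  multiplies only the imaginary part by \<open>k\<close>.\<close>

lemma res_pow_has_derivative:
  assumes "z \<noteq> 0" "k > 0"
  shows "(res_pow k has_derivative
    (\<lambda>v. res_pow k z * Complex (Re (v / z)) (k * Im (v / z)))) (at z)"
proof -
  obtain l where k: "k = Suc l" using assms by (cases k) auto
  have p: "((\<lambda>z. z ^ k) has_derivative (\<lambda>v. of_nat k * (v / z) * z ^ k)) (at z)"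
    by (rule has_derivative_eq_rhs[OF has_derivative_power[OF has_derivative_ident]])
       (use assms in \<open>auto simp: k\<close>)
  have q: "((\<lambda>z. complex_of_real (inverse (norm z)) ^ (k - 1)) has_derivative
     (\<lambda>v. complex_of_real (- (real (k - 1) * inverse (norm z) ^ (k - 1) * Re (v / z))))) (at z)"
    using bounded_linear.has_derivative[OF bounded_linear_of_real[where 'a = complex]
        inverse_norm_power_has_derivative[OF assms(1), of "k - 1"]]
    by simp
  have C: "Complex (Re (v / z)) (k * Im (v / z)) = of_nat k * (v / z) - of_nat (k - 1) * of_real (Re (v / z))" for v
    by (auto simp: complex_eq_iff k algebra_simps simp del: times_divide_eq_right)
  show ?thesis
    unfolding res_pow_eq[abs_def] C
    by (rule has_derivative_eq_rhs[OF has_derivative_mult_left[OF has_derivative_mult[OF p q]]])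
       (auto simp: algebra_simps k)
qed

text \<open>Infinitesimally, a change of moduli dilates the plane of \<open>\<mu>1\<close> and \<open>\<mu>2\<close>, and a change of the
  phase \<open>m * arg (a$1) - n * arg (a$2)\<close> rotates it: both multiply
  \<open>\<mu>1 - \<i> \<mu>2 = res_pow m (a$1) * cnj (res_pow n (a$2))\<close> by \<open>S + \<i> T\<close>.\<close>

definition DJres :: "nat \<Rightarrow> nat \<Rightarrow> complex^2 \<Rightarrow> complex^2 \<Rightarrow> real^3" where
  "DJres n m a v =
    (let w1 = v$1 / a$1; w2 = v$2 / a$2; \<mu> = Jres n m a;
         S = Re w1 + Re w2; T = m * Im w1 - n * Im w2
     in vector [\<mu>$1 * S + \<mu>$2 * T, \<mu>$2 * S - \<mu>$1 * T,
                (cmod (a$1))\<^sup>2 / m * Re w1 + (cmod (a$2))\<^sup>2 / n * Re w2])"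

lemma Jres_nth:
  "Jres n m a $ 1 = Re (res_pow m (a$1) * cnj (res_pow n (a$2)))"
  "Jres n m a $ 2 = - Im (res_pow m (a$1) * cnj (res_pow n (a$2)))"
  "Jres n m a $ 3 = ((cmod (res_pow m (a$1)))\<^sup>2 + (cmod (res_pow n (a$2)))\<^sup>2) / 2"
  by (simp_all add: Jres_def J11_def)

lemma Jres_has_derivative:
  assumes "n > 0" "m > 0" "a \<in> Cx2"
  shows "(Jres n m has_derivative DJres n m a) (at a)"
proof (rule has_derivative_vecI)
  fix i :: 3
  have a: "a$1 \<noteq> 0" "a$2 \<noteq> 0" using assms(3) by (auto simp: Cx2_def)
  have nth: "((\<lambda>x::complex^2. x $ j) has_derivative (\<lambda>v. v $ j)) (at a)" for j
    by (intro bounded_linear_imp_has_derivative bounded_linear_vec_nth)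
  note b1 = has_derivative_compose[OF nth res_pow_has_derivative[OF a(1) assms(2)]]
  note b2 = has_derivative_compose[OF nth res_pow_has_derivative[OF a(2) assms(1)]]
  note c2 = bounded_linear.has_derivative[OF bounded_linear_cnj b2]
  note z = has_derivative_mult[OF b1 c2]
  have "((\<lambda>x. Jres n m x $ 1) has_derivative (\<lambda>v. DJres n m a v $ 1)) (at a)"
    unfolding Jres_nth
    by (rule has_derivative_eq_rhs[OF bounded_linear.has_derivative[OF bounded_linear_Re z]])
       (simp add: fun_eq_iff DJres_def Let_def Jres_nth, simp add: algebra_simps)
  moreover have "((\<lambda>x. Jres n m x $ 2) has_derivative (\<lambda>v. DJres n m a v $ 2)) (at a)"
    unfolding Jres_nth
    by (rule has_derivative_eq_rhs[OF has_derivative_minus[OF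
          bounded_linear.has_derivative[OF bounded_linear_Im z]]])
       (simp add: fun_eq_iff DJres_def Let_def Jres_nth, simp add: algebra_simps)
  moreover have "((\<lambda>x. Jres n m x $ 3) has_derivative (\<lambda>v. DJres n m a v $ 3)) (at a)"
  proof -
    have "((\<lambda>x. (res_pow m (x$1) \<bullet> res_pow m (x$1) + res_pow n (x$2) \<bullet> res_pow n (x$2)) * (1/2))
       has_derivative (\<lambda>v. DJres n m a v $ 3)) (at a)"
      by (rule has_derivative_eq_rhs[OF has_derivative_mult_left[OF has_derivative_add[OF
            has_derivative_inner[OF b1 b1] has_derivative_inner[OF b2 b2]]]])
         (unfold DJres_def Let_def norm_res_pow_sq[OF a(1) assms(2), symmetric]
            norm_res_pow_sq[OF a(2) assms(1), symmetric],
          simp add: fun_eq_iff inner_complex_def cmod_power2, simp add: algebra_simps power2_eq_square)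
    then show ?thesis by (simp add: Jres_nth power2_norm_eq_inner)
  qed
  ultimately show "((\<lambda>x. Jres n m x $ i) has_derivative (\<lambda>v. DJres n m a v $ i)) (at a)"
    using exhaust_3[of i] by auto
qed

lemma Jres_sq_sum:
  assumes "n > 0" "m > 0" "a \<in> Cx2"
  shows "(Jres n m a $ 1)\<^sup>2 + (Jres n m a $ 2)\<^sup>2 = (cmod (a$1))\<^sup>2 / m * ((cmod (a$2))\<^sup>2 / n)"
proof -
  have a: "a$1 \<noteq> 0" "a$2 \<noteq> 0" using assms(3) by (auto simp: Cx2_def)
  have "(Jres n m a $ 1)\<^sup>2 + (Jres n m a $ 2)\<^sup>2 = (cmod (res_pow m (a$1) * cnj (res_pow n (a$2))))\<^sup>2"
    unfolding cmod_power2 Jres_nth by (simp add: power2_eq_square algebra_simps)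
  then show ?thesis
    by (simp add: norm_mult power_mult_distrib norm_res_pow_sq a assms)
qed

lemma Jres_3:
  assumes "n > 0" "m > 0" "a \<in> Cx2"
  shows "Jres n m a $ 3 = ((cmod (a$1))\<^sup>2 / m + (cmod (a$2))\<^sup>2 / n) / 2"
  using assms by (simp add: Jres_nth norm_res_pow_sq Cx2_def)


section \<open>The Poisson property\<close>

lemma smooth_on_Jres:
  assumes "n > 0" "m > 0"
  shows "smooth_on (Jres n m) Cx2"
proof -
  have b: "Ck_on k (\<lambda>a. res_pow j (a$i)) Cx2" for k j i
    using exhaust_2[of i]
    by (intro Ck_on_res_pow open_Cx2 Ck_on_bounded_linear[OF bounded_linear_vec_nth] Ck_on_id)
       (auto simp: Cx2_def)
  have z: "Ck_on k (\<lambda>a. res_pow m (a$1) * cnj (res_pow n (a$2))) Cx2" for k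
    by (intro Ck_on_mult Ck_on_bounded_linear[OF bounded_linear_cnj] open_Cx2 b)
  have "Ck_on k (\<lambda>a. Jres n m a $ i) Cx2" for k i
  proof -
    have "Ck_on k (\<lambda>a. Jres n m a $ 1) Cx2"
      unfolding Jres_nth by (intro Ck_on_bounded_linear[OF bounded_linear_Re] z open_Cx2)
    moreover have "Ck_on k (\<lambda>a. Jres n m a $ 2) Cx2"
      unfolding Jres_nth
      by (intro Ck_on_bounded_linear[OF bounded_linear_compose[OF
              bounded_linear_minus[OF bounded_linear_ident] bounded_linear_Im]] z open_Cx2)
    moreover have "Ck_on k (\<lambda>a. Jres n m a $ 3) Cx2"
      unfolding Jres_nth power2_norm_eq_inner divide_inverse
      by (intro Ck_on_mult Ck_on_add Ck_on_const open_Cx2 b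
          Ck_on_bounded_bilinear[OF bounded_bilinear_inner])
    ultimately show ?thesis using exhaust_3[of i] by auto
  qed
  then show ?thesis unfolding smooth_on_def by (intro allI Ck_on_vecI open_Cx2)
qed

lemma smooth_on_Rres: "smooth_on (Rres n m) Cx2"
proof -
  have "Rres n m = (\<lambda>a. (a$1 \<bullet> a$1) * (1 / (2 * real m)) + (a$2 \<bullet> a$2) * (- 1 / (2 * real n)))"
    by (simp add: fun_eq_iff Rres_def power2_norm_eq_inner diff_divide_distrib)
  then show ?thesis unfolding smooth_on_def
    by (simp only:) (intro allI Ck_on_mult Ck_on_add Ck_on_const open_Cx2 Ck_on_id
          Ck_on_bounded_bilinear[OF bounded_bilinear_inner]
          Ck_on_bounded_linear[OF bounded_linear_vec_nth])
qed

lemma smooth_on_UNIV_differentiable: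
  "smooth_on F UNIV \<Longrightarrow> F differentiable (at x)"
  unfolding smooth_on_def by (metis Ck_on.simps(2) UNIV_I)

text \<open>In one factor, with \<open>z = x + \<i> y\<close>, the Wirtinger form \<open>2 \<i> (F_z G_cnj - G_z F_cnj)\<close> is the
  determinant \<open>F_y G_x - F_x G_y\<close>. A determinant scales by area under a change of frame, so the
  coordinate frame may be replaced by the radial and the angular direction at \<open>a\<close>, which span the
  area \<open>|a$j|^2\<close>.\<close>

lemma poisson_polar:
  assumes F: "(F has_derivative DF) (at a)" and G: "(G has_derivative DG) (at a)"
    and a: "a \<in> Cx2"
  shows "poisson F G a =
    (DF (axis 1 (\<i> * a$1)) * DG (axis 1 (a$1)) - DF (axis 1 (a$1)) * DG (axis 1 (\<i> * a$1))) / (cmod (a$1))\<^sup>2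
    - (DF (axis 2 (\<i> * a$2)) * DG (axis 2 (a$2)) - DF (axis 2 (a$2)) * DG (axis 2 (\<i> * a$2))) / (cmod (a$2))\<^sup>2"
proof -
  have eq: "frechet_derivative F (at a) = DF" "frechet_derivative G (at a) = DG"
    using F G by (simp_all flip: frechet_derivative_at)
  have lin: "D (axis j z) = Re z * D (axis j 1) + Im z * D (axis j \<i>)"
    if "linear D" for D :: "complex^2 \<Rightarrow> real" and j z
  proof -
    have "axis j z = Re z *\<^sub>R axis j 1 + Im z *\<^sub>R (axis j \<i> :: complex^2)"
      by (auto simp: vec_eq_iff axis_def complex_eq_iff)
    then show ?thesis using that by (simp add: linear_add linear_scale)
  qed
  have "linear DF" "linear DG"
    using F G by (auto dest: has_derivative_linear)
  note l = lin[OF this(1), of 1 "_ * _"] lin[OF this(1), of 2 "_ * _"]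
     lin[OF this(1), of 1 "a$1"] lin[OF this(1), of 2 "a$2"]
     lin[OF this(2), of 1 "_ * _"] lin[OF this(2), of 2 "_ * _"]
     lin[OF this(2), of 1 "a$1"] lin[OF this(2), of 2 "a$2"]
  have area: "((- y * f + x * f') * (x * g + y * g') - (x * f + y * f') * (- y * g + x * g')) / (x\<^sup>2 + y\<^sup>2) =
       f' * g - f * g'" if "x\<^sup>2 + y\<^sup>2 \<noteq> 0" for x y f f' g g' :: real
  proof -
    have "(- y * f + x * f') * (x * g + y * g') - (x * f + y * f') * (- y * g + x * g') =
       (f' * g - f * g') * (x\<^sup>2 + y\<^sup>2)"
      by algebra
    then show ?thesis using that by simp
  qed
  have nz: "(Re (a$j))\<^sup>2 + (Im (a$j))\<^sup>2 \<noteq> 0" for j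
    using a exhaust_2[of j] by (auto simp: Cx2_def sum_power2_eq_zero_iff complex_eq_iff)
  have "poisson F G a = (DF (axis 1 \<i>) * DG (axis 1 1) - DF (axis 1 1) * DG (axis 1 \<i>))
      - (DF (axis 2 \<i>) * DG (axis 2 1) - DF (axis 2 1) * DG (axis 2 \<i>))"
    by (simp add: poisson_def poisson_cx_def sum_2 ksgn_def wirt_def wirt_bar_def eq)
       (simp add: field_simps)
  then show ?thesis
    using area[OF nz[of 1]] area[OF nz[of 2]]
    by (simp add: l cmod_power2)
qed

text \<open>Under \<open>hat\<close> the pairing is the Euclidean inner product, so \<open>fun_deriv\<close> is the gradient, and
  the commutators of the basis are \<open>[e1,e2] = 2 e3\<close>, \<open>[e2,e3] = - 2 e1\<close>, \<open>[e3,e1] = - 2 e2\<close>.\<close>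

lemma lie_poisson_plus_eq:
  assumes F: "(F has_derivative DF) (at \<mu>)" and G: "(G has_derivative DG) (at \<mu>)"
  defines "f \<equiv> \<lambda>i. DF (axis i 1)" and "g \<equiv> \<lambda>i. DG (axis i 1)"
  shows "lie_poisson_plus F G \<mu> =
    2 * (\<mu>$3 * (f 1 * g 2 - f 2 * g 1) - \<mu>$1 * (f 2 * g 3 - f 3 * g 2) - \<mu>$2 * (f 3 * g 1 - f 1 * g 3))"
proof -
  have grad: "fun_deriv H \<mu> = hat (\<chi> i. DH (axis i 1))"
    if H: "(H has_derivative DH) (at \<mu>)" for H DH
  proof -
    have "linear DH" using H by (rule has_derivative_linear)
    have D: "DH \<delta> = \<delta> \<bullet> (\<chi> i. DH (axis i 1))" for \<delta>
    proof -
      have "\<delta> = (\<Sum>i\<in>UNIV. \<delta>$i *\<^sub>R axis i 1)"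
        by (simp add: vec_eq_iff axis_def if_distrib cong: if_cong)
      then have "DH \<delta> = DH (\<Sum>i\<in>UNIV. \<delta>$i *\<^sub>R axis i 1)" by (rule arg_cong)
      also have "\<dots> = (\<Sum>i\<in>UNIV. \<delta>$i * DH (axis i 1))"
        by (simp add: linear_sum[OF \<open>linear DH\<close>] linear_scale[OF \<open>linear DH\<close>])
      finally show ?thesis by (simp add: inner_vec_def)
    qed
    have pair: "su11_pairing (hat \<delta>) (hat \<nu>) = \<delta> \<bullet> \<nu>" for \<delta> \<nu>
      unfolding su11_pairing_def su11_pairing_hat by simp
    have eq: "frechet_derivative H (at \<mu>) = DH" using H by (simp flip: frechet_derivative_at)
    show ?thesis
      unfolding fun_deriv_def eq
    proof (rule the_equality)
      show "hat (\<chi> i. DH (axis i 1)) \<in> su11 \<and>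
          (\<forall>\<delta>. su11_pairing (hat \<delta>) (hat (\<chi> i. DH (axis i 1))) = DH \<delta>)"
        unfolding pair su11_hat by (auto simp only: D[symmetric])
    next
      fix \<xi> assume "\<xi> \<in> su11 \<and> (\<forall>\<delta>. su11_pairing (hat \<delta>) \<xi> = DH \<delta>)"
      then obtain \<nu> where \<nu>: "\<xi> = hat \<nu>" "\<And>\<delta>. \<delta> \<bullet> \<nu> = DH \<delta>"
        unfolding su11_hat using pair by auto
      have "\<delta> \<bullet> \<nu> = \<delta> \<bullet> (\<chi> i. DH (axis i 1))" for \<delta>
        using \<nu>(2) D by (rule trans)
      then have "\<nu> = (\<chi> i. DH (axis i 1))" by (metis vector_eq_ldot)
      then show "\<xi> = hat (\<chi> i. DH (axis i 1))" using \<nu> by simp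
    qed
  qed
  have "su11_pairing (hat \<mu>) (commutator (hat x) (hat y)) =
    2 * (\<mu>$3 * (x$1 * y$2 - x$2 * y$1) - \<mu>$1 * (x$2 * y$3 - x$3 * y$2) - \<mu>$2 * (x$3 * y$1 - x$1 * y$3))" for x y
    by (simp add: su11_pairing_def commutator_def hat_def cadjoint_def matrix_matrix_mult_def
        sum_2 trace_def)
       (simp add: algebra_simps)
  then show ?thesis
    unfolding lie_poisson_plus_def grad[OF F] grad[OF G] by (simp add: f_def g_def)
qed

text \<open>Both \<open>F \<circ> R\<close> and \<open>G \<circ> R\<close> have differentials proportional to that of \<open>R\<close>, so every
  determinant in \<open>poisson_polar\<close> vanishes.\<close>

lemma poisson_map_Rres: "poisson_map Cx2 poisson zero_bracket (Rres n m)"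
  unfolding poisson_map_def
proof (intro conjI allI impI ballI smooth_on_Rres)
  fix F G :: "real \<Rightarrow> real" and a
  assume "smooth_on F UNIV \<and> smooth_on G UNIV" and a: "a \<in> Cx2"
  then obtain DF DG where F: "(F has_derivative DF) (at (Rres n m a))" and
      G: "(G has_derivative DG) (at (Rres n m a))"
    using smooth_on_UNIV_differentiable unfolding differentiable_def by meson
  have D: "((H \<circ> Rres n m) has_derivative
      (\<lambda>v. ((a$1) \<bullet> (v$1) / real m - (a$2) \<bullet> (v$2) / real n) * DH 1)) (at a)"
    if H: "(H has_derivative DH) (at (Rres n m a))" for H DH :: "real \<Rightarrow> real"
  proof -
    have lin: "DH x = x * DH 1" for x
      using linear_scale[OF has_derivative_linear[OF H], of x 1] by simp
    show ?thesis
      by (rule has_derivative_eq_rhs[OF diff_chain_at[OF Rres_has_derivative H]])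
         (unfold o_def, rule ext, rule lin)
  qed
  show "poisson (F \<circ> Rres n m) (G \<circ> Rres n m) a = zero_bracket F G (Rres n m a)"
    unfolding poisson_polar[OF D[OF F] D[OF G] a] by (simp add: zero_bracket_def)
qed

text \<open>The angular derivatives carry a factor \<open>m\<close> or \<open>- n\<close>, which the areas \<open>m p\<close> and \<open>n q\<close> of the
  frames cancel. What remains no longer depends on the weights; since \<open>\<mu>1^2 + \<mu>2^2 = p q\<close>, the
  coefficient of \<open>\<mu>1\<close> against \<open>\<mu>2\<close> is \<open>p q / p + p q / q = p + q = 2 \<mu>3\<close>.\<close>

lemma poisson_map_Jres:
  assumes nm: "n > 0" "m > 0"
  shows "poisson_map Cx2 poisson lie_poisson_plus (Jres n m)"
  unfolding poisson_map_def
proof (intro conjI allI impI ballI smooth_on_Jres nm)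
  fix F G :: "real^3 \<Rightarrow> real" and a
  assume "smooth_on F UNIV \<and> smooth_on G UNIV" and a: "a \<in> Cx2"
  then obtain DF DG where F: "(F has_derivative DF) (at (Jres n m a))" and
      G: "(G has_derivative DG) (at (Jres n m a))"
    using smooth_on_UNIV_differentiable unfolding differentiable_def by meson
  define p q where "p = (cmod (a$1))\<^sup>2 / m" and "q = (cmod (a$2))\<^sup>2 / n"
  define x y where "x = Jres n m a $ 1" and "y = Jres n m a $ 2"
  have a0: "a$1 \<noteq> 0" "a$2 \<noteq> 0" using a by (auto simp: Cx2_def)
  then have pq: "p > 0" "q > 0" using nm by (simp_all add: p_def q_def)
  have xy: "x\<^sup>2 + y\<^sup>2 = p * q" using Jres_sq_sum[OF nm a] by (simp add: x_def y_def p_def q_def)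
  have sq: "(cmod (a$1))\<^sup>2 = m * p" "(cmod (a$2))\<^sup>2 = n * q" using nm by (simp_all add: p_def q_def)
  have D: "((H \<circ> Jres n m) has_derivative
      (\<lambda>v. DJres n m a v $ 1 * DH (axis 1 1) + DJres n m a v $ 2 * DH (axis 2 1)
         + DJres n m a v $ 3 * DH (axis 3 1))) (at a)"
    if H: "(H has_derivative DH) (at (Jres n m a))" for H DH
  proof -
    have "DH w = w$1 * DH (axis 1 1) + w$2 * DH (axis 2 1) + w$3 * DH (axis 3 1)" for w
    proof -
      have "w = w$1 *\<^sub>R axis 1 1 + w$2 *\<^sub>R axis 2 1 + w$3 *\<^sub>R axis 3 1"
        by (simp add: vec_eq_iff forall_3 axis_def)
      then have "DH w = DH (w$1 *\<^sub>R axis 1 1 + w$2 *\<^sub>R axis 2 1 + w$3 *\<^sub>R axis 3 1)"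
        by (rule arg_cong)
      then show ?thesis
        using has_derivative_linear[OF H] by (simp add: linear_add linear_scale)
    qed
    then have "DH \<circ> DJres n m a = (\<lambda>v. DJres n m a v $ 1 * DH (axis 1 1)
         + DJres n m a v $ 2 * DH (axis 2 1) + DJres n m a v $ 3 * DH (axis 3 1))"
      unfolding o_def by (rule ext)
    with diff_chain_at[OF Jres_has_derivative[OF nm a] H] show ?thesis by simp
  qed
  have J: "DJres n m a (axis 1 (a$1)) = vector [x, y, p]"
    "DJres n m a (axis 1 (\<i> * a$1)) = vector [real m * y, - real m * x, 0]"
    "DJres n m a (axis 2 (a$2)) = vector [x, y, q]"
    "DJres n m a (axis 2 (\<i> * a$2)) = vector [- real n * y, - (- real n) * x, 0]"
    using a0 by (simp_all add: DJres_def Let_def axis_def x_def y_def p_def q_def mult.commute)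
  \<comment> \<open>The contribution of one factor; \<open>c = m\<close> in the first and \<open>c = - n\<close> in the second.\<close>
  have area: "((c * y * f1 + - c * x * f2 + 0 * f3) * (x * g1 + y * g2 + r * g3)
        - (x * f1 + y * f2 + r * f3) * (c * y * g1 + - c * x * g2 + 0 * g3)) / (k * r) =
        c / k * (p * q / r * (f1 * g2 - f2 * g1) + y * (f1 * g3 - f3 * g1) - x * (f2 * g3 - f3 * g2))"
    if "r \<noteq> 0" for c k r f1 f2 f3 g1 g2 g3 :: real
  proof -
    have "(c * y * f1 + - c * x * f2 + 0 * f3) * (x * g1 + y * g2 + r * g3)
        - (x * f1 + y * f2 + r * f3) * (c * y * g1 + - c * x * g2 + 0 * g3) =
        c * ((x\<^sup>2 + y\<^sup>2) * (f1 * g2 - f2 * g1) + r * (y * (f1 * g3 - f3 * g1) - x * (f2 * g3 - f3 * g2)))"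
      by (simp add: algebra_simps power2_eq_square)
    moreover have "c * (P * A + r * B) / (k * r) = c / k * (P / r * A + B)" for P A B
      using that by (simp add: add_divide_distrib distrib_left)
    ultimately show ?thesis unfolding xy by (simp add: add_diff_eq)
  qed
  have c: "real m / real m = 1" "- real n / real n = - 1" "p * q / p = q" "p * q / q = p"
    using nm pq by simp_all
  have "poisson (F \<circ> Jres n m) (G \<circ> Jres n m) a =
     (let f = (\<lambda>i. DF (axis i 1)); g = (\<lambda>i. DG (axis i 1)) in
     (p + q) * (f 1 * g 2 - f 2 * g 1) - 2 * x * (f 2 * g 3 - f 3 * g 2) - 2 * y * (f 3 * g 1 - f 1 * g 3))"
    unfolding poisson_polar[OF D[OF F] D[OF G] a] J sq vector_3
      area[OF pq(1)[THEN less_imp_neq, symmetric]] area[OF pq(2)[THEN less_imp_neq, symmetric]] c Let_def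
    by (simp add: algebra_simps)
  also have "\<dots> = lie_poisson_plus F G (Jres n m a)"
  proof -
    have "p + q = 2 * Jres n m a $ 3" by (simp add: Jres_3[OF nm a] p_def q_def mult.commute)
    then show ?thesis
      unfolding lie_poisson_plus_eq[OF F G] Let_def x_def y_def by (simp add: algebra_simps)
  qed
  finally show "poisson (F \<circ> Jres n m) (G \<circ> Jres n m) a = lie_poisson_plus F G (Jres n m a)" .
qed


section \<open>The dual pair and the Kummer shape\<close>

lemma Omega_polar:
  assumes "a \<in> Cx2"
  shows "Omega v w =
    (cmod (a$1))\<^sup>2 * (Im (v$1 / a$1) * Re (w$1 / a$1) - Re (v$1 / a$1) * Im (w$1 / a$1))
    - (cmod (a$2))\<^sup>2 * (Im (v$2 / a$2) * Re (w$2 / a$2) - Re (v$2 / a$2) * Im (w$2 / a$2))"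
proof -
  have area: "(cmod z)\<^sup>2 * (Im (x / z) * Re (y / z) - Re (x / z) * Im (y / z)) = Im (x * cnj y)"
    if "z \<noteq> 0" for x y z
  proof -
    have "Im (x / z) * Re (y / z) - Re (x / z) * Im (y / z) = Im (x / z * cnj (y / z))"
      by (simp del: complex_cnj_divide times_divide_eq_left times_divide_eq_right)
    also have "x / z * cnj (y / z) = x * cnj y / of_real ((cmod z)\<^sup>2)"
      by (simp only: complex_norm_square complex_cnj_divide times_divide_times_eq)
    also have "Im (x * cnj y / of_real ((cmod z)\<^sup>2)) = Im (x * cnj y) / (cmod z)\<^sup>2" by (rule Im_divide_of_real)
    finally show ?thesis using that by simp
  qed
  show ?thesis using assms
    by (simp add: area Cx2_def Omega_def Omega_cx_def sum_2 ksgn_def)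
       (simp add: field_simps)
qed

lemma kerT_Rres:
  assumes "a \<in> Cx2"
  shows "kerT (Rres n m) a =
    {v. (cmod (a$1))\<^sup>2 / m * Re (v$1 / a$1) = (cmod (a$2))\<^sup>2 / n * Re (v$2 / a$2)}"
proof -
  have r: "z \<bullet> x = (cmod z)\<^sup>2 * Re (x / z)" if "z \<noteq> 0" for z x :: complex
  proof -
    have "(cmod z)\<^sup>2 * Re (x / z) = (cmod z)\<^sup>2 * ((Re x * Re z + Im x * Im z) / (cmod z)\<^sup>2)"
      by (simp add: Re_divide cmod_power2)
    then show ?thesis using that by (simp add: inner_complex_def mult.commute)
  qed
  have "frechet_derivative (Rres n m) (at a) = (\<lambda>v. (a$1) \<bullet> (v$1) / real m - (a$2) \<bullet> (v$2) / real n)"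
    by (rule frechet_derivative_at[OF Rres_has_derivative, symmetric])
  then show ?thesis using assms by (simp add: kerT_def r Cx2_def)
qed

text \<open>The first two components of the derivative are the image of \<open>(S, T)\<close> under a linear map of
  determinant \<open>- (\<mu>1^2 + \<mu>2^2) \<noteq> 0\<close>, so they vanish only for \<open>S = T = 0\<close>. With \<open>S = 0\<close>
  the third is \<open>2 R s_1\<close>: the factor \<open>R\<close> is where the null cone enters.\<close>

lemma kerT_Jres:
  assumes nm: "n > 0" "m > 0" and a: "a \<in> Cx2"
  shows "kerT (Jres n m) a =
    {v. Re (v$1 / a$1) + Re (v$2 / a$2) = 0
      \<and> m * Im (v$1 / a$1) = n * Im (v$2 / a$2)
      \<and> Rres n m a * Re (v$1 / a$1) = 0}"
proof -
  define p q where "p = (cmod (a$1))\<^sup>2 / m" and "q = (cmod (a$2))\<^sup>2 / n"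
  define x y where "x = Jres n m a $ 1" and "y = Jres n m a $ 2"
  have pq: "p > 0" "q > 0" using a nm by (simp_all add: p_def q_def Cx2_def)
  have xy: "x\<^sup>2 + y\<^sup>2 = p * q" using Jres_sq_sum[OF nm a] by (simp add: x_def y_def p_def q_def)
  have R: "Rres n m a = (p - q) / 2" by (simp add: Rres_def p_def q_def)
  have "(DJres n m a v = 0) \<longleftrightarrow>
    (Re (v$1 / a$1) + Re (v$2 / a$2) = 0 \<and> m * Im (v$1 / a$1) = n * Im (v$2 / a$2)
      \<and> Rres n m a * Re (v$1 / a$1) = 0)" for v
  proof -
    define s1 s2 where "s1 = Re (v$1 / a$1)" and "s2 = Re (v$2 / a$2)"
    define T where "T = m * Im (v$1 / a$1) - n * Im (v$2 / a$2)"
    have 1: "(DJres n m a v = 0) \<longleftrightarrow>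
      x * (s1 + s2) + y * T = 0 \<and> y * (s1 + s2) - x * T = 0 \<and> p * s1 + q * s2 = 0"
      by (simp add: DJres_def Let_def vec_eq_iff forall_3 x_def y_def p_def q_def s1_def s2_def T_def)
    have 2: "x * (s1 + s2) + y * T = 0 \<and> y * (s1 + s2) - x * T = 0 \<longleftrightarrow> s1 + s2 = 0 \<and> T = 0"
    proof
      assume "x * (s1 + s2) + y * T = 0 \<and> y * (s1 + s2) - x * T = 0"
      then have "(x\<^sup>2 + y\<^sup>2) * (s1 + s2) = 0 \<and> (x\<^sup>2 + y\<^sup>2) * T = 0" by algebra
      then show "s1 + s2 = 0 \<and> T = 0" using xy pq by simp
    qed simp
    have 3: "p * s1 + q * s2 = 2 * (Rres n m a * s1)" if "s1 + s2 = 0"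
    proof -
      have "s2 = - s1" using that by simp
      then show ?thesis by (simp add: R algebra_simps)
    qed
    have "DJres n m a v = 0 \<longleftrightarrow> s1 + s2 = 0 \<and> T = 0 \<and> Rres n m a * s1 = 0"
      using 1 2 3 by auto
    then show ?thesis by (simp add: T_def s1_def s2_def)
  qed
  moreover have "frechet_derivative (Jres n m) (at a) = DJres n m a"
    by (rule frechet_derivative_at[OF Jres_has_derivative[OF nm a], symmetric])
  ultimately show ?thesis by (simp add: kerT_def)
qed

text \<open>Up to sign, the Hamiltonian vector of \<open>Rres n m\<close>: contracting it with \<open>Omega\<close> gives
  \<open>\<plusminus>dR\<close>. It turns the arguments at rates \<open>1/m\<close> and \<open>1/n\<close>, which leaves moduli and
  \<open>m * arg (a$1) - n * arg (a$2)\<close> unchanged and so is invisible to \<open>Jres n m\<close>.\<close>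

definition flow_dir :: "nat \<Rightarrow> nat \<Rightarrow> complex^2 \<Rightarrow> complex^2" where
  "flow_dir n m a = vector [\<i> * a$1 / m, \<i> * a$2 / n]"

lemma flow_dir_nth:
  assumes "a \<in> Cx2"
  shows "flow_dir n m a $ 1 / a $ 1 = Complex 0 (1 / m)" "flow_dir n m a $ 2 / a $ 2 = Complex 0 (1 / n)"
  using assms by (simp_all add: flow_dir_def Cx2_def Complex_eq)

lemma Omega_flow_dir:
  assumes "a \<in> Cx2"
  shows "Omega v (flow_dir n m a) = 0 \<longleftrightarrow> v \<in> kerT (Rres n m) a"
  unfolding Omega_polar[OF assms] kerT_Rres[OF assms] flow_dir_nth[OF assms] by auto

lemma flow_dir_in_kerT_Jres:
  assumes "n > 0" "m > 0" "a \<in> Cx2"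
  shows "flow_dir n m a \<in> kerT (Jres n m) a"
  unfolding kerT_Jres[OF assms] mem_Collect_eq flow_dir_nth[OF assms(3)] using assms by simp

lemma symp_orth_kerT_Jres:
  assumes "n > 0" "m > 0" "a \<in> Cx2"
  shows "symp_orth (kerT (Jres n m) a) \<subseteq> kerT (Rres n m) a"
  using flow_dir_in_kerT_Jres[OF assms] Omega_flow_dir[OF assms(3)]
  by (auto simp: symp_orth_def)

lemma symp_orth_kerT_Rres:
  assumes nm: "n > 0" "m > 0" and a: "a \<in> Cx2"
  shows "symp_orth (kerT (Rres n m) a) =
    {v. Re (v$1 / a$1) = 0 \<and> Re (v$2 / a$2) = 0 \<and> m * Im (v$1 / a$1) = n * Im (v$2 / a$2)}"
    (is "_ = ?L")
proof -
  have a0: "a$1 \<noteq> 0" "a$2 \<noteq> 0" using a by (auto simp: Cx2_def)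
  define p q where "p = (cmod (a$1))\<^sup>2 / m" and "q = (cmod (a$2))\<^sup>2 / n"
  have pq: "p > 0" "q > 0" using a0 nm by (simp_all add: p_def q_def)
  have sq: "(cmod (a$1))\<^sup>2 = m * p" "(cmod (a$2))\<^sup>2 = n * q" using nm by (simp_all add: p_def q_def)
  have ker: "v \<in> kerT (Rres n m) a \<longleftrightarrow> p * Re (v$1 / a$1) = q * Re (v$2 / a$2)" for v
    by (simp only: kerT_Rres[OF a] p_def q_def mem_Collect_eq)
  show ?thesis
  proof (intro set_eqI iffI)
    fix v assume v: "v \<in> symp_orth (kerT (Rres n m) a)"
    have test: "Omega v (vector [w1 * a$1, w2 * a$2]) = 0" if "p * Re w1 = q * Re w2" for w1 w2
    proof -
      have "vector [w1 * a$1, w2 * a$2] \<in> kerT (Rres n m) a"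
        using that a0 by (simp add: ker)
      then show ?thesis using v unfolding symp_orth_def by blast
    qed
    \<comment> \<open>Probe with a rotation in each factor, then with the dilation that is tangent to the
      level set of \<open>R\<close>.\<close>
    have "Re (v$1 / a$1) = 0" "Re (v$2 / a$2) = 0"
      using test[of \<i> 0] test[of 0 \<i>] a0 by (simp_all add: Omega_polar[OF a])
    moreover have "p * q * (m * Im (v$1 / a$1)) = p * q * (n * Im (v$2 / a$2))"
      using test[of "of_real q" "of_real p"] a0 by (simp add: Omega_polar[OF a] sq algebra_simps)
    ultimately show "v \<in> ?L" using pq by simp
  next
    fix v assume v: "v \<in> ?L"
    show "v \<in> symp_orth (kerT (Rres n m) a)"
      unfolding symp_orth_def
    proof (intro CollectI ballI)
      fix w assume "w \<in> kerT (Rres n m) a"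
      then have w: "p * Re (w$1 / a$1) = q * Re (w$2 / a$2)"
        by (simp add: ker)
      have "Omega v w = (m * Im (v$1 / a$1)) * (p * Re (w$1 / a$1)) - (n * Im (v$2 / a$2)) * (q * Re (w$2 / a$2))"
        unfolding Omega_polar[OF a] sq using v by simp
      also have "\<dots> = 0" unfolding w using v by simp
      finally show "Omega v w = 0" .
    qed
  qed
qed

lemma symp_orth_kerT_Rres_subset:
  assumes "n > 0" "m > 0" "a \<in> Cx2"
  shows "symp_orth (kerT (Rres n m) a) \<subseteq> kerT (Jres n m) a"
  unfolding symp_orth_kerT_Rres[OF assms] kerT_Jres[OF assms]
  by (rule Collect_mono) simp

text \<open>Where \<open>R \<noteq> 0\<close>, the kernel of \<open>dJ\<close> shrinks to the Hamiltonian line of \<open>R\<close>. That the second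
  complement is no smaller than \<open>ker dR\<close> is the general inclusion of a subspace in its double
  complement.\<close>

lemma dual_pair_Rres_Jres:
  assumes nm: "n > 0" "m > 0" and a: "a \<in> Cx2" and "Rres n m a \<noteq> 0"
  shows "dual_pair_at (Rres n m) (Jres n m) a"
proof -
  have J: "symp_orth (kerT (Rres n m) a) = kerT (Jres n m) a"
    unfolding symp_orth_kerT_Rres[OF nm a] kerT_Jres[OF nm a] using assms(4) by auto
  have "Omega v w = 0" if "Omega w v = 0" for v w
    using that by (simp add: Omega_polar[OF a] algebra_simps)
  then have "kerT (Rres n m) a \<subseteq> symp_orth (symp_orth (kerT (Rres n m) a))"
    unfolding symp_orth_def by blast
  with symp_orth_kerT_Jres[OF nm a] show ?thesis
    unfolding dual_pair_at_def J by blast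
qed

lemma Jres_cone:
  assumes "n > 0" "m > 0" "a \<in> Cx2"
  shows "(Jres n m a $ 3)\<^sup>2 - (Jres n m a $ 1)\<^sup>2 - (Jres n m a $ 2)\<^sup>2 = (Rres n m a)\<^sup>2"
proof -
  have "((p + q) / 2)\<^sup>2 - p * q = ((p - q) / 2)\<^sup>2" for p q :: real
    by (simp add: power2_eq_square field_simps)
  then show ?thesis
    unfolding diff_diff_eq Jres_sq_sum[OF assms] Jres_3[OF assms] Rres_def .
qed

text \<open>Divide the argument by \<open>k\<close>; any of the \<open>k\<close> branches would do.\<close>

lemma res_pow_surj:
  assumes "b \<noteq> 0" "k > 0"
  obtains z where "z \<noteq> 0" "res_pow k z = b"
proof
  obtain l where k: "k = Suc l" using assms by (cases k) auto
  define z where "z = rcis (sqrt k * cmod b) (Arg b / k)"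
  show "z \<noteq> 0" using assms by (simp add: z_def)
  have "z ^ k = rcis ((sqrt k * cmod b) ^ k) (Arg b)"
    using assms by (simp add: z_def DeMoivre2)
  also have "\<dots> = of_real ((sqrt k * cmod b) ^ l * sqrt k) * rcis (cmod b) (Arg b)"
    by (simp add: rcis_def k)
  finally have "z ^ k = of_real ((sqrt k * cmod b) ^ l * sqrt k) * b" by (simp add: rcis_cmod_Arg)
  moreover have "cmod z = sqrt k * cmod b" by (simp add: z_def)
  ultimately show "res_pow k z = b" using assms by (simp add: res_pow_def k)
qed

lemma Rres_eq_fres:
  assumes "n > 0" "m > 0" "a \<in> Cx2"
  shows "Rres n m a = Rres 1 1 (fres n m a)"
  using assms by (simp add: Rres_def Cx2_def norm_res_pow_sq)

text \<open>On the sheet, \<open>\<mu>3 > \<bar>r\<bar>\<close>, so the squared moduli \<open>\<mu>3 + r\<close> and \<open>\<mu>3 - r\<close> that a preimage under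
  \<open>J11\<close> must have are positive; one coordinate can be chosen real, as only the relative phase
  matters.\<close>

lemma image_Jres:
  assumes nm: "n > 0" "m > 0"
  shows "Jres n m ` {a \<in> Cx2. Rres n m a = r} = kummer_sheet r"
proof (intro equalityI subsetI)
  fix \<mu> assume "\<mu> \<in> Jres n m ` {a \<in> Cx2. Rres n m a = r}"
  then obtain a where a: "a \<in> Cx2" and r: "Rres n m a = r" and \<mu>: "\<mu> = Jres n m a" by auto
  have pos: "(cmod (a$1))\<^sup>2 / m > 0" "(cmod (a$2))\<^sup>2 / n > 0"
    using a nm by (auto simp: Cx2_def)
  have "\<mu>$3 > 0" unfolding \<mu> Jres_3[OF nm a] using pos by simp
  moreover have "(\<mu>$1)\<^sup>2 + (\<mu>$2)\<^sup>2 > 0"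
    unfolding \<mu> Jres_sq_sum[OF nm a] using pos by (rule mult_pos_pos)
  ultimately show "\<mu> \<in> kummer_sheet r"
    using Jres_cone[OF nm a] by (auto simp: kummer_sheet_def \<mu> r)
next
  fix \<mu> assume "\<mu> \<in> kummer_sheet r"
  then have pos: "\<mu>$3 > 0" and cone: "(\<mu>$3)\<^sup>2 - (\<mu>$1)\<^sup>2 - (\<mu>$2)\<^sup>2 = r\<^sup>2" and "\<mu>$1 \<noteq> 0 \<or> \<mu>$2 \<noteq> 0"
    by (auto simp: kummer_sheet_def)
  then have z0: "Complex (\<mu>$1) (- (\<mu>$2)) \<noteq> 0" by (auto simp: complex_eq_iff)
  have "(\<mu>$1)\<^sup>2 + (\<mu>$2)\<^sup>2 > 0" using \<open>\<mu>$1 \<noteq> 0 \<or> \<mu>$2 \<noteq> 0\<close> by (simp add: sum_power2_gt_zero_iff)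
  then have "\<bar>r\<bar> < \<mu>$3"
    using cone pos by (auto intro: power2_less_imp_less simp del: abs_less_iff)
  then have q: "\<mu>$3 - r > 0" by simp
  define b2 where "b2 = sqrt (\<mu>$3 - r)"
  define b1 where "b1 = Complex (\<mu>$1) (- (\<mu>$2)) / of_real b2"
  have b2: "b2 > 0" "b2\<^sup>2 = \<mu>$3 - r" using q by (simp_all add: b2_def)
  have b1: "b1 \<noteq> 0" using z0 b2 by (simp add: b1_def)
  obtain z1 where z1: "z1 \<noteq> 0" "res_pow m z1 = b1"
    by (rule res_pow_surj[OF b1 nm(2)])
  obtain z2 where z2: "z2 \<noteq> 0" "res_pow n z2 = of_real b2"
    using b2 nm res_pow_surj[of "of_real b2" n] by auto
  have "(cmod b1)\<^sup>2 = ((\<mu>$1)\<^sup>2 + (\<mu>$2)\<^sup>2) / (\<mu>$3 - r)"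
    unfolding b1_def norm_divide power_divide using b2 by (simp add: cmod_power2)
  also have "(\<mu>$1)\<^sup>2 + (\<mu>$2)\<^sup>2 = (\<mu>$3 + r) * (\<mu>$3 - r)"
    using cone by (simp add: algebra_simps power2_eq_square)
  finally have nb1: "(cmod b1)\<^sup>2 = \<mu>$3 + r" using q by simp
  define a :: "complex^2" where "a = vector [z1, z2]"
  have a: "a \<in> Cx2" using z1 z2 by (simp add: a_def Cx2_def)
  have "Rres n m a = r"
    unfolding Rres_eq_fres[OF nm a] using z1 z2 b2 nb1 by (simp add: Rres_def a_def)
  moreover have "Jres n m a = \<mu>"
  proof -
    have "b1 * of_real b2 = Complex (\<mu>$1) (- (\<mu>$2))" using b2 by (simp add: b1_def)
    then show ?thesis
      using z1 z2 b2 nb1 by (simp add: vec_eq_iff forall_3 Jres_nth a_def)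
  qed
  ultimately show "\<mu> \<in> Jres n m ` {a \<in> Cx2. Rres n m a = r}" using a by auto
qed

theorem mainTheorem4:
  fixes n m :: nat
  assumes "n > 0" and "m > 0"
  shows "poisson_map Cx2 poisson zero_bracket (Rres n m)
       \<and> poisson_map Cx2 poisson lie_poisson_plus (Jres n m)
       \<and> (\<forall>a\<in>Cx2. Rres n m a \<noteq> 0 \<longrightarrow> dual_pair_at (Rres n m) (Jres n m) a)
       \<and> (\<forall>a\<in>Cx2. symp_orth (kerT (Rres n m) a) \<subseteq> kerT (Jres n m) a
                 \<and> symp_orth (kerT (Jres n m) a) \<subseteq> kerT (Rres n m) a)
       \<and> (\<forall>a\<in>Cx2. fres n m a \<in> Cx2
                 \<and> Rres n m a = Rres 1 1 (fres n m a)
                 \<and> Jres n m a = J11 (fres n m a))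
       \<and> (\<forall>r. Jres n m ` {a \<in> Cx2. Rres n m a = r} = kummer_sheet r)
       \<and> (\<forall>a\<in>Cx2. let \<mu> = Jres n m a in
                 (\<mu>$3)^2 - (\<mu>$1)^2 - (\<mu>$2)^2 = (Rres n m a)^2)"
proof (intro conjI ballI allI impI)
  fix a :: "complex^2" assume a: "a \<in> Cx2"
  show "fres n m a \<in> Cx2" using a assms by (rule fres_Cx2)
  show "Rres n m a = Rres 1 1 (fres n m a)" using assms a by (rule Rres_eq_fres)
  show "Jres n m a = J11 (fres n m a)" by (simp add: Jres_def)
  show "let \<mu> = Jres n m a in (\<mu>$3)^2 - (\<mu>$1)^2 - (\<mu>$2)^2 = (Rres n m a)^2"
    using Jres_cone[OF assms a] by (simp add: Let_def)
  show "symp_orth (kerT (Rres n m) a) \<subseteq> kerT (Jres n m) a"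
    using assms a by (rule symp_orth_kerT_Rres_subset)
  show "symp_orth (kerT (Jres n m) a) \<subseteq> kerT (Rres n m) a"
    using assms a by (rule symp_orth_kerT_Jres)
  show "dual_pair_at (Rres n m) (Jres n m) a" if "Rres n m a \<noteq> 0"
    using assms a that by (rule dual_pair_Rres_Jres)
qed (rule poisson_map_Rres poisson_map_Jres[OF assms] image_Jres[OF assms])+

end
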